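(* Let $N\geq 2$ be an even integer, let $\mathcal{H}_{1/2}\cong\mathbb{C}^2$ be the spin $1/2$ (fundamental) unitary representation space of $\mathrm{SU}(2)$, and let $\vec{j}=(\tfrac12,\ldots,\tfrac12)$ ($N$ entries). Let $V_{\vec{j}}$ be the Rovelli-Smolin-DePietri volume operator on $\mathcal{H}_{1/2}^{\otimes N}$, which preserves the subspace $\mathrm{Inv}(\mathcal{H}_{1/2}^{\otimes N})$ of $\mathrm{SU}(2)$-invariant tensors. Then the restriction of $V_{\vec{j}}$ to $\mathrm{Inv}(\mathcal{H}_{1/2}^{\otimes N})$ is proportional to the identity, and $$V_{\vec{j}}=\frac{\kappa_0}{8}\left(\frac{8\pi G\hbar\gamma}{c^3}\right)^{\frac32}\sqrt{\frac{\sqrt3}{3!}(N-2)N(N+2)}\cdot \mathbb{1}\qquad\text{on } \mathrm{Inv}(\mathcal{H}_{1/2}^{\otimes N}).$$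
   Context: $\kappa_0, G,\hbar,\gamma,c$ are fixed positive real constants. For a spin $j\in\frac12\mathbb{N}$ let $\rho_j:\mathrm{SU}(2)\to \mathrm{GL}(\mathcal{H}_j)$ be the unitary irreducible representation of dimension $2j+1$, and let $\rho_j'(\tau)=\frac{d}{dt}\big|_{t=0}\rho_j(\exp(t\tau))$ be the induced representation of the Lie algebra $\mathrm{su}(2)$. Let $\tau^i=\frac{1}{2\mathrm{i}}\sigma^i$, $i=1,2,3$, where $\sigma^i$ are the Pauli matrices. $\mathrm{Inv}(\mathcal{H}_{j}^{\otimes N})$ is the subspace of vectors $\iota\in\mathcal{H}_j^{\otimes N}$ with $\rho_j(u)^{\otimes N}\iota=\iota$ for all $u\in\mathrm{SU}(2)$. For $\vec{j}=(j_1,\ldots,j_N)$ define on $\mathcal{H}_{j_1}\otimes\cdots\otimes\mathcal{H}_{j_N}$ the operators $$J^i_I=\mathbb{1}\otimes\cdots\otimes\mathbb{1}\otimes\rho_{j_I}'(\tau^i)\otimes\mathbb{1}\otimes\cdots\otimes\mathbb{1}\quad(\rho'_{j_I}(\tau^i)\text{ in the } I\text{-th factor}),$$ $$\hat q_{\vec{j}}=\frac18\sum_{1\le I<J<K\le N}\left|\epsilon_{ijk}J^i_IJ^j_JJ^k_K\right| ,\qquad V_{\vec{j}}=\kappa_0\left(\frac{8\pi G\hbar\gamma}{c^3}\right)^{\frac32}\sqrt{|\hat q_{\vec{j}}|}.$$ Here $\epsilon_{ijk}$ is the Levi-Civita symbol with summation over $i,j,k\in\{1,2,3\}$ understood, $|A|=\sqrt{A^*A}$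 for an operator $A$ on a finite-dimensional Hilbert space, and $\sqrt{\cdot}$ is the positive square root of a positive semidefinite operator. *)

theory Defs
  imports
    "HOL-Analysis.Derivative"
    "Jordan_Normal_Form.Schur_Decomposition"
begin

section \<open>Operators on finite-dimensional Hilbert spaces\<close>

text \<open>The Hilbert spaces are the spaces \<open>carrier_vec d\<close> of complex vectors with their standard
  inner product, and operators are complex matrices.\<close>

definition psd :: "complex mat \<Rightarrow> bool" where
  "psd A \<longleftrightarrow> square_mat A \<and> mat_adjoint A = A \<and>
    (\<forall>v \<in> carrier_vec (dim_row A). 0 \<le> Re ((A *\<^sub>v v) \<bullet>c v))"

definition psd_sqrt :: "complex mat \<Rightarrow> complex mat" where
  "psd_sqrt A = (THE B. B \<in> carrier_mat (dim_row A) (dim_row A) \<and> psd B \<and> B * B = A)"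

definition abs_op :: "complex mat \<Rightarrow> complex mat" where
  "abs_op A = psd_sqrt (mat_adjoint A * A)"

definition mat_exp :: "complex mat \<Rightarrow> complex mat" where
  "mat_exp A = mat (dim_row A) (dim_row A) (\<lambda>(r, s). \<Sum>k. (A ^\<^sub>m k) $$ (r, s) / fact k)"

definition mat_sum :: "nat \<Rightarrow> ('i \<Rightarrow> complex mat) \<Rightarrow> 'i set \<Rightarrow> complex mat" where
  "mat_sum d f S = mat d d (\<lambda>(r, s). \<Sum>x\<in>S. f x $$ (r, s))"

definition kron :: "complex mat \<Rightarrow> complex mat \<Rightarrow> complex mat" where
  "kron A B = mat (dim_row A * dim_row B) (dim_col A * dim_col B)
    (\<lambda>(r, s). A $$ (r div dim_row B, s div dim_col B) * B $$ (r mod dim_row B, s mod dim_col B))"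

definition tensor_op :: "complex mat list \<Rightarrow> complex mat" where
  "tensor_op As = foldr kron As (1\<^sub>m 1)"


section \<open>Representations of SU(2)\<close>

definition SU2 :: "complex mat set" where
  "SU2 = {u \<in> carrier_mat 2 2. mat_adjoint u * u = 1\<^sub>m 2 \<and> det u = 1}"

definition pauli :: "nat \<Rightarrow> complex mat" where
  "pauli i =
    (if i = 1 then mat_of_rows_list 2 [[0, 1], [1, 0]]
     else if i = 2 then mat_of_rows_list 2 [[0, - \<i>], [\<i>, 0]]
     else mat_of_rows_list 2 [[1, 0], [0, - 1]])"

definition tau :: "nat \<Rightarrow> complex mat" where
  "tau i = (1 / (2 * \<i>)) \<cdot>\<^sub>m pauli i"

text \<open>A spin \<open>j\<close> is encoded by the natural number \<open>n = 2 * j\<close>. The representation space is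
  \<open>Sym\<^sup>n \<complex>\<^sup>2\<close>, realised as the homogeneous polynomials of degree \<open>n\<close> in \<open>x, y\<close> with orthonormal basis
  \<open>e\<^sub>k = sqrt (n choose k) * x ^ (n - k) * y ^ k\<close> for \<open>k = 0, \<dots>, n\<close>. The group element \<open>u\<close> acts by the
  substitution \<open>x \<mapsto> u\<^sub>0\<^sub>0 * x + u\<^sub>1\<^sub>0 * y\<close> and \<open>y \<mapsto> u\<^sub>0\<^sub>1 * x + u\<^sub>1\<^sub>1 * y\<close>; below \<open>x\<close> is set to \<open>1\<close>, so
  that the coefficient of \<open>y ^ l\<close> determines the component along \<open>e\<^sub>l\<close>.\<close>

definition spin_rep :: "nat \<Rightarrow> complex mat \<Rightarrow> complex mat" where
  "spin_rep n u = mat (n + 1) (n + 1) (\<lambda>(l, k).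
     complex_of_real (sqrt (real (n choose k) / real (n choose l))) *
     coeff ([:u $$ (0, 0), u $$ (1, 0):] ^ (n - k) * [:u $$ (0, 1), u $$ (1, 1):] ^ k) l)"

lemma spin_rep_fundamental:
  assumes "u \<in> carrier_mat 2 2"
  shows "spin_rep 1 u = u"
proof (rule eq_matI)
  fix l k assume "l < dim_row u" "k < dim_col u"
  then have "(l = 0 \<or> l = 1) \<and> (k = 0 \<or> k = 1)" using assms by auto
  then show "spin_rep 1 u $$ (l, k) = u $$ (l, k)"
    by (auto simp: spin_rep_def)
qed (use assms in \<open>auto simp: spin_rep_def\<close>)

definition spin_rep_deriv :: "nat \<Rightarrow> complex mat \<Rightarrow> complex mat" where
  "spin_rep_deriv n X = mat (n + 1) (n + 1) (\<lambda>(r, s).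
     vector_derivative (\<lambda>t. spin_rep n (mat_exp (complex_of_real t \<cdot>\<^sub>m X)) $$ (r, s)) (at 0))"


section \<open>The volume operator\<close>

text \<open>A list \<open>js\<close> contains the doubled spins \<open>2 * j\<close> of the tensor factors, which are numbered
  from \<open>0\<close>; the index \<open>i\<close> of \<open>tau i\<close> ranges over \<open>{1, 2, 3}\<close>.\<close>

definition tensor_dim :: "nat list \<Rightarrow> nat" where
  "tensor_dim js = (\<Prod>n\<leftarrow>js. n + 1)"

definition Inv :: "nat list \<Rightarrow> complex vec set" where
  "Inv js = {\<iota> \<in> carrier_vec (tensor_dim js).
     \<forall>u\<in>SU2. tensor_op (map (\<lambda>n. spin_rep n u) js) *\<^sub>v \<iota> = \<iota>}"

definition J_op :: "nat list \<Rightarrow> nat \<Rightarrow> nat \<Rightarrow> complex mat" where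
  "J_op js I i = tensor_op (map (\<lambda>K.
     if K = I then spin_rep_deriv (js ! K) (tau i) else 1\<^sub>m (js ! K + 1)) [0..<length js])"

definition levi_civita :: "nat \<Rightarrow> nat \<Rightarrow> nat \<Rightarrow> complex" where
  "levi_civita i j k =
    (if (i, j, k) \<in> {(1, 2, 3), (2, 3, 1), (3, 1, 2)} then 1
     else if (i, j, k) \<in> {(3, 2, 1), (2, 1, 3), (1, 3, 2)} then - 1
     else 0)"

definition triple_op :: "nat list \<Rightarrow> nat \<Rightarrow> nat \<Rightarrow> nat \<Rightarrow> complex mat" where
  "triple_op js I J K = mat_sum (tensor_dim js)
     (\<lambda>(i, j, k). levi_civita i j k \<cdot>\<^sub>m (J_op js I i * J_op js J j * J_op js K k))
     ({1..3} \<times> {1..3} \<times> {1..3})"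

definition q_op :: "nat list \<Rightarrow> complex mat" where
  "q_op js = (1 / 8) \<cdot>\<^sub>m mat_sum (tensor_dim js)
     (\<lambda>(I, J, K). abs_op (triple_op js I J K))
     {(I, J, K). I < J \<and> J < K \<and> K < length js}"

definition volume_op ::
  "real \<Rightarrow> real \<Rightarrow> real \<Rightarrow> real \<Rightarrow> real \<Rightarrow> nat list \<Rightarrow> complex mat" where
  "volume_op \<kappa>\<^sub>0 G hbar \<gamma> c js =
     complex_of_real (\<kappa>\<^sub>0 * (8 * pi * G * hbar * \<gamma> / c ^ 3) powr (3 / 2)) \<cdot>\<^sub>m
     psd_sqrt (abs_op (q_op js))"

end

(*
  On spin 1/2 the operator epsilon_ijk J^i_I J^j_J J^k_K is i/8 times the triple product
  T = sigma_I . (sigma_J x sigma_K). With Y = 3 - sigma_I.sigma_J - sigma_J.sigma_K - sigma_I.sigma_K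
  the Pauli relations give T^2 = 2 Y and Y^2 = 6 Y, so Y is positive semidefinite and
  |epsilon_ijk J^i_I J^j_J J^k_K| = sqrt 3 / 24 * Y. Every pair of factors lies in N - 2 triples, hence
  the sum of Y over all triples is N - 2 times the sum of 1 - sigma_I.sigma_J over all pairs.
  On invariant tensors the total spin vanishes, and its square turns the latter sum into
  N (N + 2) / 2. Thus invariant tensors are eigenvectors of q, and a positive semidefinite B with
  B^2 v = b^2 v and b >= 0 satisfies B v = b v, which passes the eigenvalue to the square root.
*)

theory Submission
  imports Defs "Jordan_Normal_Form.Jordan_Normal_Form_Existence"
    "Jordan_Normal_Form.Jordan_Normal_Form_Uniqueness"
begin

text \<open>\<open>psd_sqrt\<close> is a definite description, so nothing can be said about a root
  before existence and uniqueness are known in every dimension. For a single triple a multiple of Y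
  is an explicit candidate and uniqueness suffices. The outer root is taken of q on the whole tensor
  space, where q is in general no scalar, so existence is needed as well. It comes from the Jordan
  normal form, whose change of basis is not known to be unitary; self-adjointness and positivity of
  the root therefore need arguments of their own.

  Invariance speaks about group elements, vanishing of the total spin about generators.
  Differentiating a tensor power of a curve in SU(2) is avoided: for each basis component one
  diagonal group element at a finite angle settles axis 3, and conjugation with group elements that
  turn axis 3 into axes 1 and 2 settles the rest.\<close>

unbundle no inner_syntax and no vec_syntax

section \<open>Positive semidefinite matrices\<close>

lemma dim_mat_adjoint [simp]:
  "dim_row (mat_adjoint A) = dim_col A" "dim_col (mat_adjoint A) = dim_row A"
  by (simp_all add: mat_adjoint_def)

lemma mat_adjoint_carrier [simp]: "A \<in> carrier_mat m n \<Longrightarrow> mat_adjoint A \<in> carrier_mat n m"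
  by auto

lemma index_mat_adjoint [simp]:
  "i < dim_col A \<Longrightarrow> j < dim_row A \<Longrightarrow> mat_adjoint A $$ (i, j) = conjugate (A $$ (j, i))"
  by (simp add: mat_adjoint_def mat_of_rows_index)

lemma square_mult_carrier [simp]:
  "A \<in> carrier_mat n n \<Longrightarrow> B \<in> carrier_mat n n \<Longrightarrow> A * B \<in> carrier_mat n n"
  by (rule mult_carrier_mat)

lemmas square_mult_assoc = assoc_mult_mat[of _ n n _ n _ n] for n

lemma adjoint_mult:
  fixes A B :: "complex mat"
  assumes "A \<in> carrier_mat l m" "B \<in> carrier_mat m n"
  shows "mat_adjoint (A * B) = mat_adjoint B * mat_adjoint A"
  by (rule eq_matI) (use assms in \<open>auto simp: scalar_prod_def mult.commute intro!: sum.cong\<close>)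

lemma adjoint_smult:
  fixes A :: "complex mat"
  shows "mat_adjoint (a \<cdot>\<^sub>m A) = cnj a \<cdot>\<^sub>m mat_adjoint A"
  by (rule eq_matI) auto

lemma adjoint_one: "mat_adjoint (1\<^sub>m n :: complex mat) = 1\<^sub>m n"
  by (rule eq_matI) auto

lemma cscalar_prod_adjoint:
  fixes A :: "complex mat"
  assumes A: "A \<in> carrier_mat n m" and v: "v \<in> carrier_vec m" and w: "w \<in> carrier_vec n"
  shows "(A *\<^sub>v v) \<bullet>c w = v \<bullet>c (mat_adjoint A *\<^sub>v w)"
proof -
  have "(A *\<^sub>v v) \<bullet>c w = (\<Sum>i<n. \<Sum>j<m. A $$ (i, j) * v $ j * cnj (w $ i))"
    using assms by (auto simp: scalar_prod_def sum_distrib_right atLeast0LessThan intro!: sum.cong)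
  also have "\<dots> = (\<Sum>j<m. \<Sum>i<n. A $$ (i, j) * v $ j * cnj (w $ i))"
    by (rule sum.swap)
  also have "\<dots> = v \<bullet>c (mat_adjoint A *\<^sub>v w)"
    using assms by (auto simp: scalar_prod_def sum_distrib_left atLeast0LessThan mult_ac intro!: sum.cong)
  finally show ?thesis .
qed

lemma cscalar_prod_self_nonneg: "0 \<le> Re (v \<bullet>c v)" and cscalar_prod_self_real: "Im (v \<bullet>c v) = 0"
  for v :: "complex vec"
  using conjugate_square_ge_0_vec[of v] by (auto simp: less_eq_complex_def)

lemma cscalar_prod_self_eq_0:
  fixes v :: "complex vec"
  assumes "v \<in> carrier_vec n" "Re (v \<bullet>c v) \<le> 0"
  shows "v = 0\<^sub>v n"
proof -
  have "v \<bullet>c v = 0"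
    using assms(2) cscalar_prod_self_nonneg[of v] cscalar_prod_self_real[of v] by (simp add: complex_eq_iff)
  then show ?thesis using conjugate_square_eq_0_vec[OF assms(1)] by simp
qed

lemma psdI:
  assumes "A \<in> carrier_mat n n" "mat_adjoint A = A"
    "\<And>v. v \<in> carrier_vec n \<Longrightarrow> 0 \<le> Re ((A *\<^sub>v v) \<bullet>c v)"
  shows "psd A"
  using assms by (auto simp: psd_def)

lemma psdD:
  assumes "psd A" "A \<in> carrier_mat n n"
  shows "mat_adjoint A = A" "v \<in> carrier_vec n \<Longrightarrow> 0 \<le> Re ((A *\<^sub>v v) \<bullet>c v)"
  using assms by (auto simp: psd_def)

lemma psd_adjoint_mult:
  assumes A: "A \<in> carrier_mat m n"
  shows "psd (mat_adjoint A * A)"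
proof (rule psdI)
  show "mat_adjoint A * A \<in> carrier_mat n n" using A by auto
  have adj: "mat_adjoint (mat_adjoint A) = A" by (rule eq_matI) auto
  show "mat_adjoint (mat_adjoint A * A) = mat_adjoint A * A"
    using adjoint_mult[of "mat_adjoint A" n m A n] A by (simp add: adj)
  fix v :: "complex vec" assume v: "v \<in> carrier_vec n"
  have "(mat_adjoint A * A *\<^sub>v v) \<bullet>c v = (mat_adjoint A *\<^sub>v (A *\<^sub>v v)) \<bullet>c v"
    using A v by (simp add: assoc_mult_mat_vec[of _ n m _ n])
  also have "\<dots> = (A *\<^sub>v v) \<bullet>c (A *\<^sub>v v)"
    using cscalar_prod_adjoint[of "mat_adjoint A" n m "A *\<^sub>v v" v] A v by (simp add: adj)
  finally show "0 \<le> Re ((mat_adjoint A * A *\<^sub>v v) \<bullet>c v)"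
    by (simp add: cscalar_prod_self_nonneg)
qed

lemma smult_mat_mult_vec:
  fixes A :: "complex mat"
  assumes "v \<in> carrier_vec (dim_col A)"
  shows "(a \<cdot>\<^sub>m A) *\<^sub>v v = a \<cdot>\<^sub>v (A *\<^sub>v v)"
  by (rule eq_vecI) (use assms in auto)

lemma psd_smult:
  assumes "psd A" "0 \<le> a"
  shows "psd (complex_of_real a \<cdot>\<^sub>m A)"
proof -
  obtain n where A: "A \<in> carrier_mat n n" using assms(1) by (auto simp: psd_def)
  show ?thesis
  proof (rule psdI)
    show "complex_of_real a \<cdot>\<^sub>m A \<in> carrier_mat n n" using A by simp
    show "mat_adjoint (complex_of_real a \<cdot>\<^sub>m A) = complex_of_real a \<cdot>\<^sub>m A"
      using psdD(1)[OF assms(1) A] by (simp add: adjoint_smult)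
    fix v :: "complex vec" assume v: "v \<in> carrier_vec n"
    have "complex_of_real a \<cdot>\<^sub>m A *\<^sub>v v = complex_of_real a \<cdot>\<^sub>v (A *\<^sub>v v)"
      by (rule eq_vecI) (use A v in auto)
    then have "Re ((complex_of_real a \<cdot>\<^sub>m A *\<^sub>v v) \<bullet>c v) = a * Re ((A *\<^sub>v v) \<bullet>c v)"
      using A v by simp
    then show "0 \<le> Re ((complex_of_real a \<cdot>\<^sub>m A *\<^sub>v v) \<bullet>c v)"
      using psdD(2)[OF assms(1) A v] assms(2) by simp
  qed
qed

text \<open>Since \<open>(B + b) (B - b) v = 0\<close>, the vector \<open>w = B v - b v\<close>
  satisfies \<open>B w = - b w\<close>, and a positive semidefinite operator has no negative
  eigenvalue. Serves both the uniqueness of roots and the passage of the final eigenvalue to the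
  volume operator.\<close>

lemma psd_eigenvector_of_square:
  assumes B: "B \<in> carrier_mat n n" "psd B" and v: "v \<in> carrier_vec n" and b: "0 \<le> b"
    and eig: "B *\<^sub>v (B *\<^sub>v v) = (complex_of_real b)\<^sup>2 \<cdot>\<^sub>v v"
  shows "B *\<^sub>v v = complex_of_real b \<cdot>\<^sub>v v"
proof -
  define w where "w = B *\<^sub>v v - complex_of_real b \<cdot>\<^sub>v v"
  have w: "w \<in> carrier_vec n" using B v by (auto simp: w_def)
  have Bw: "B *\<^sub>v w = - complex_of_real b \<cdot>\<^sub>v w"
  proof -
    have "B *\<^sub>v w = B *\<^sub>v (B *\<^sub>v v) - complex_of_real b \<cdot>\<^sub>v (B *\<^sub>v v)"
      using B v unfolding w_def
      by (subst mult_minus_distrib_mat_vec[of _ n n]) (auto simp: mult_mat_vec[of _ n n])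
    also have "\<dots> = - complex_of_real b \<cdot>\<^sub>v w"
      unfolding eig w_def by (rule eq_vecI) (use B v in \<open>auto simp: power2_eq_square algebra_simps\<close>)
    finally show ?thesis .
  qed
  have "w = 0\<^sub>v n"
  proof (cases "b = 0")
    case True
    \<comment> \<open>For \<open>b = 0\<close> the sign argument is empty; instead
      \<open>B v\<close> has squared norm \<open><v, B (B v)> = 0\<close>.\<close>
    have "B *\<^sub>v (B *\<^sub>v v) = 0\<^sub>v n" unfolding eig True using v by (auto intro!: eq_vecI)
    then have "Re ((B *\<^sub>v v) \<bullet>c (B *\<^sub>v v)) = 0"
      using cscalar_prod_adjoint[OF B(1) v, of "B *\<^sub>v v"] B v psdD[OF B(2,1)] by simp
    then show ?thesis
      using cscalar_prod_self_eq_0[of "B *\<^sub>v v" n] B v True by (auto simp: w_def)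
  next
    case False
    have "0 \<le> Re ((B *\<^sub>v w) \<bullet>c w)" using psdD(2)[OF B(2,1) w] .
    also have "\<dots> = - b * Re (w \<bullet>c w)"
      using w by (simp add: Bw cscalar_prod_self_real)
    finally have "Re (w \<bullet>c w) \<le> 0"
      using False b by (simp add: mult_le_0_iff)
    then show ?thesis by (rule cscalar_prod_self_eq_0[OF w])
  qed
  then have "(B *\<^sub>v v - complex_of_real b \<cdot>\<^sub>v v) + complex_of_real b \<cdot>\<^sub>v v = 0\<^sub>v n + complex_of_real b \<cdot>\<^sub>v v"
    by (simp add: w_def)
  then show ?thesis using B v by (auto intro!: eq_vecI simp: vec_eq_iff)
qed

section \<open>Diagonalization of positive semidefinite matrices\<close>

text \<open>If \<open>w = (A - e) v\<close> is killed by \<open>A - e\<close>, self-adjointness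
  gives \<open>e <w,w> = cnj e <w,w>\<close> and \<open><w,w> = (cnj e - e) <v,w>\<close>. For real
  \<open>e\<close> the second identity yields \<open><w,w> = 0\<close>, for other \<open>e\<close>
  the first does. So no generalised eigenvector of rank two exists.\<close>

lemma hermitian_kernel_char_matrix:
  fixes A :: "complex mat"
  assumes A: "A \<in> carrier_mat n n" "mat_adjoint A = A"
  shows "mat_kernel (char_matrix A e ^\<^sub>m 2) = mat_kernel (char_matrix A e ^\<^sub>m 1)"
proof -
  let ?C = "char_matrix A e"
  have C: "?C \<in> carrier_mat n n" using A by (simp add: char_matrix_def)
  have C_eq: "?C *\<^sub>v v = A *\<^sub>v v - e \<cdot>\<^sub>v v" if v: "v \<in> carrier_vec n" for v
    using A v unfolding char_matrix_def
    by (subst add_mult_distrib_mat_vec[of _ n n]) (auto intro!: eq_vecI)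
  have "?C *\<^sub>v v = 0\<^sub>v n" if v: "v \<in> carrier_vec n" and 0: "?C *\<^sub>v (?C *\<^sub>v v) = 0\<^sub>v n" for v
  proof -
    define w where "w = ?C *\<^sub>v v"
    have w: "w \<in> carrier_vec n" using C v by (simp add: w_def)
    have "A *\<^sub>v w - e \<cdot>\<^sub>v w = 0\<^sub>v n" using 0 C_eq[OF w] by (simp add: w_def)
    then have "(A *\<^sub>v w - e \<cdot>\<^sub>v w) + e \<cdot>\<^sub>v w = e \<cdot>\<^sub>v w" using w by simp
    then have Aw: "A *\<^sub>v w = e \<cdot>\<^sub>v w" using w A by (auto simp: vec_eq_iff)
    have conj: "x \<bullet>c (e \<cdot>\<^sub>v w) = cnj e * (x \<bullet>c w)" if "x \<in> carrier_vec n" for x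
      using that w by (simp add: conjugate_smult_vec)
    have "e * (w \<bullet>c w) = cnj e * (w \<bullet>c w)"
      using cscalar_prod_adjoint[OF A(1) w w] w conj[OF w] by (simp add: Aw A(2))
    moreover have "w \<bullet>c w = (cnj e - e) * (v \<bullet>c w)"
    proof -
      have "w \<bullet>c w = (A *\<^sub>v v - e \<cdot>\<^sub>v v) \<bullet>c w" by (simp add: w_def C_eq[OF v, symmetric])
      also have "\<dots> = (A *\<^sub>v v) \<bullet>c w - (e \<cdot>\<^sub>v v) \<bullet>c w"
        by (rule minus_scalar_prod_distrib[of _ n]) (use A v w in auto)
      also have "\<dots> = (cnj e - e) * (v \<bullet>c w)"
        using cscalar_prod_adjoint[OF A(1) v w] conj[OF v] v w by (simp add: Aw A(2) algebra_simps)
      finally show ?thesis .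
    qed
    ultimately have "w \<bullet>c w = 0" by auto
    then show ?thesis using conjugate_square_eq_0_vec[OF w] by (simp add: w_def)
  qed
  moreover have "?C ^\<^sub>m 2 *\<^sub>v v = ?C *\<^sub>v (?C *\<^sub>v v)" if "v \<in> carrier_vec n" for v
    using C that by (simp add: numeral_2_eq_2)
  ultimately show ?thesis
    using C by (auto simp: mat_kernel_def)
qed

text \<open>Meant for the sizes of the Jordan blocks at one eigenvalue: a block of size
  \<open>x\<close> adds \<open>min k x\<close> to the dimension of the generalised eigenspace of
  order \<open>k\<close>. Termwise \<open>min 1 x\<close> is at most \<open>min 2 x\<close>, and
  strictly smaller once \<open>x\<close> exceeds 1.\<close>

lemma sum_list_min_eq:
  fixes xs :: "nat list"
  assumes "(\<Sum>x\<leftarrow>xs. min 2 x) = (\<Sum>x\<leftarrow>xs. min 1 x)" "x \<in> set xs"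
  shows "x \<le> 1"
  using assms
proof (induction xs)
  case (Cons y xs)
  have "(\<Sum>x\<leftarrow>xs. min 1 x) \<le> (\<Sum>x\<leftarrow>xs. min 2 x)" by (rule sum_list_mono) auto
  with Cons show ?case by (auto simp: min_def split: if_splits)
qed simp

lemma hermitian_jordan_blocks:
  fixes A :: "complex mat"
  assumes A: "A \<in> carrier_mat n n" "mat_adjoint A = A" and jnf: "jordan_nf A n_as"
    and mem: "(k, e) \<in> set n_as"
  shows "k = 1"
proof -
  have "dim_gen_eigenspace A e 2 = dim_gen_eigenspace A e 1"
    using A(1) hermitian_kernel_char_matrix[OF A, of e]
    by (simp add: dim_gen_eigenspace_def kernel_dim_def)
  then have "k \<le> 1"
    unfolding dim_gen_eigenspace[OF jnf]
    by (rule sum_list_min_eq) (use mem in force)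
  moreover have "k \<noteq> 0" using jnf mem by (force simp: jordan_nf_def)
  ultimately show ?thesis by simp
qed

lemma jordan_matrix_singletons:
  assumes "\<forall>x\<in>set n_as. fst x = 1"
  shows "jordan_matrix n_as = mat (length n_as) (length n_as)
    (\<lambda>(i, j). if i = j then snd (n_as ! i) else (0 :: complex))"
  using assms
proof (induction n_as)
  case Nil
  show ?case by (rule eq_matI) (auto simp: jordan_matrix_def)
next
  case (Cons x n_as)
  have dims: "dim_row (jordan_matrix n_as) = length n_as" "dim_col (jordan_matrix n_as) = length n_as"
    using Cons by auto
  obtain a where x: "x = (1, a)" using Cons.prems by (cases x) auto
  have len: "sum_list (map fst n_as) = length n_as"
    using dims(1) by simp
  show ?case
    unfolding x jordan_matrix_Cons len
    by (rule eq_matI) (use Cons in \<open>auto simp: nth_Cons' jordan_block_def\<close>)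
qed

definition real_diag :: "nat \<Rightarrow> (nat \<Rightarrow> real) \<Rightarrow> complex mat" where
  "real_diag n d = mat n n (\<lambda>(i, j). if i = j then complex_of_real (d i) else 0)"

lemma real_diag_carrier [simp]: "real_diag n d \<in> carrier_mat n n"
  by (simp add: real_diag_def)

lemma dim_real_diag [simp]: "dim_row (real_diag n d) = n" "dim_col (real_diag n d) = n"
  by (simp_all add: real_diag_def)

lemma index_mult_real_diag:
  assumes "M \<in> carrier_mat n n" "i < n" "j < n"
  shows "(M * real_diag n d) $$ (i, j) = M $$ (i, j) * complex_of_real (d j)"
    and "(real_diag n d * M) $$ (i, j) = complex_of_real (d i) * M $$ (i, j)"
  using assms
  by (simp_all add: real_diag_def scalar_prod_def if_distrib[of "\<lambda>x. _ * x"]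
      if_distrib[of "\<lambda>x. x * _"] cong: if_cong)

lemma real_diag_mult: "real_diag n d * real_diag n d' = real_diag n (\<lambda>i. d i * d' i)"
  by (rule eq_matI) (simp_all add: index_mult_real_diag(1)[OF real_diag_carrier] del: index_mult_mat(1), simp_all add: real_diag_def)

lemma adjoint_real_diag: "mat_adjoint (real_diag n d) = real_diag n d"
  by (rule eq_matI) (auto simp: real_diag_def)

text \<open>The Jordan form is diagonal because every block has size 1. \<open>P\<close> is merely
  invertible with inverse \<open>Q\<close>; its columns are eigenvectors, and pairing
  \<open>A p\<close> with a column \<open>p\<close> shows that the eigenvalue is real and
  nonnegative.\<close>

lemma psd_diagonalization:
  assumes A: "A \<in> carrier_mat n n" "psd A"
  obtains P Q d where "P \<in> carrier_mat n n" "Q \<in> carrier_mat n n" "P * Q = 1\<^sub>m n" "Q * P = 1\<^sub>m n"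
    "A = P * real_diag n d * Q" "\<And>i. i < n \<Longrightarrow> 0 \<le> d i"
proof -
  have herm: "mat_adjoint A = A" using psdD(1)[OF A(2,1)] .
  obtain as where "char_poly A = (\<Prod>a\<leftarrow>as. [:- a, 1:])"
    using char_poly_factorized[OF A(1)] by blast
  then obtain n_as where jnf: "jordan_nf A n_as" using jordan_nf_exists[OF A(1)] by blast
  define J where "J = jordan_matrix n_as"
  obtain P Q where "similar_mat_wit A J P Q"
    using jnf by (auto simp: jordan_nf_def similar_mat_def J_def)
  note wit = similar_mat_witD[OF _ this, of n]
  have n: "n = dim_row A" using A by auto
  note P = wit(6)[OF n] and Q = wit(7)[OF n] and J = wit(5)[OF n]
    and PQ = wit(1)[OF n] and QP = wit(2)[OF n] and AJ = wit(3)[OF n]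
  have J_eq: "J = mat (length n_as) (length n_as) (\<lambda>(i, j). if i = j then snd (n_as ! i) else 0)"
    unfolding J_def by (rule jordan_matrix_singletons) (use hermitian_jordan_blocks[OF A(1) herm jnf] in auto)
  with J have len: "length n_as = n" by auto
  define d where "d i = Re (snd (n_as ! i))" for i
  have eigenvalue: "0 \<le> d i \<and> J $$ (i, i) = complex_of_real (d i)" if i: "i < n" for i
  proof -
    define p where "p = col P i"
    let ?e = "J $$ (i, i)"
    have p: "p \<in> carrier_vec n" using P i by (auto simp: p_def)
    have AP: "A * P = P * J"
    proof -
      have "A * P = P * J * (Q * P)" unfolding AJ using P Q J by (simp add: square_mult_assoc[of _ n])
      then show ?thesis using P J by (simp add: QP)
    qed
    have "A *\<^sub>v p = col (P * J) i" unfolding p_def AP[symmetric] using col_mult2[OF A(1) P i] by simp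
    also have "\<dots> = P *\<^sub>v col J i" by (rule col_mult2[OF P J i])
    also have "col J i = ?e \<cdot>\<^sub>v unit_vec n i"
      by (rule eq_vecI) (use J i in \<open>auto simp: J_eq len\<close>)
    also have "P *\<^sub>v (?e \<cdot>\<^sub>v unit_vec n i) = ?e \<cdot>\<^sub>v p"
      unfolding p_def by (rule eq_vecI) (use P i in auto)
    finally have Ap: "A *\<^sub>v p = ?e \<cdot>\<^sub>v p" .
    have "p \<noteq> 0\<^sub>v n"
    proof
      assume "p = 0\<^sub>v n"
      then have "col (Q * P) i = Q *\<^sub>v 0\<^sub>v n" using col_mult2[OF Q P i] by (simp add: p_def)
      then have "(Q * P) $$ (i, i) = 0" using P Q i by (auto simp: vec_eq_iff)
      then show False using i by (simp add: QP)
    qed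
    then have pos: "0 < Re (p \<bullet>c p)" using cscalar_prod_self_eq_0[OF p] by force
    have "?e * (p \<bullet>c p) = cnj ?e * (p \<bullet>c p)"
      using cscalar_prod_adjoint[OF A(1) p p] p by (simp add: Ap herm conjugate_smult_vec)
    then have "?e = cnj ?e" using pos by auto
    then have im: "Im ?e = 0" by (metis complex_cnj_cancel_iff complex_cnj_complex_of_real Im_complex_of_real complex_eq_cancel_iff2 complex_surj cnj.sel(2) equal_neg_zero)
    have "0 \<le> Re (?e * (p \<bullet>c p))" using psdD(2)[OF A(2,1) p] p by (simp add: Ap)
    then have "0 \<le> Re ?e" using pos im by (simp add: zero_le_mult_iff)
    then show ?thesis using im i by (simp add: d_def J_eq len complex_eq_iff)
  qed
  have "J = real_diag n d"
    by (rule eq_matI) (use eigenvalue J in \<open>auto simp: real_diag_def J_eq len\<close>)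
  then show thesis using that[OF P Q PQ QP] AJ eigenvalue by blast
qed

text \<open>If \<open>P D Q\<close> is Hermitian then \<open>Q Q\<^sup>*\<close> commutes with \<open>D\<close>, hence with every function of \<open>D\<close>.\<close>

lemma adjoint_conj_real_diag:
  fixes P Q :: "complex mat"
  assumes P: "P \<in> carrier_mat n n" and Q: "Q \<in> carrier_mat n n"
    and PQ: "P * Q = 1\<^sub>m n" and QP: "Q * P = 1\<^sub>m n"
    and herm: "mat_adjoint (P * real_diag n d * Q) = P * real_diag n d * Q"
  shows "mat_adjoint (P * real_diag n (\<lambda>i. f (d i)) * Q) = P * real_diag n (\<lambda>i. f (d i)) * Q"
proof -
  define P' Q' M where "P' = mat_adjoint P" and "Q' = mat_adjoint Q" and "M = Q * Q'"
  have P': "P' \<in> carrier_mat n n" and Q': "Q' \<in> carrier_mat n n" and M: "M \<in> carrier_mat n n"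
    using P Q by (auto simp: P'_def Q'_def M_def)
  note assoc = square_mult_assoc[of _ n]
  have adj: "mat_adjoint (P * real_diag n h * Q) = Q' * real_diag n h * P'" for h
    using P Q by (simp add: adjoint_mult[of _ n n _ n] adjoint_real_diag P'_def Q'_def assoc)
  have P'Q': "P' * Q' = 1\<^sub>m n"
    using adjoint_mult[OF Q P] by (simp add: QP adjoint_one P'_def Q'_def)
  have Q'P': "Q' * P' = 1\<^sub>m n"
    using adjoint_mult[OF P Q] by (simp add: PQ adjoint_one P'_def Q'_def)
  have "Q * (P * real_diag n d * Q) * Q' = Q * (Q' * real_diag n d * P') * Q'"
    using herm by (simp add: adj)
  moreover have "Q * (P * real_diag n d * Q) * Q' = (Q * P) * real_diag n d * M"
    using P Q Q' by (simp add: M_def assoc)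
  moreover have "Q * (Q' * real_diag n d * P') * Q' = M * real_diag n d * (P' * Q')"
    using P' Q Q' by (simp add: M_def assoc)
  ultimately have comm: "real_diag n d * M = M * real_diag n d"
    using M by (simp add: QP P'Q')
  have "real_diag n (\<lambda>i. f (d i)) * M = M * real_diag n (\<lambda>i. f (d i))"
  proof (rule eq_matI)
    fix i j assume "i < dim_row (M * real_diag n (\<lambda>i. f (d i)))" "j < dim_col (M * real_diag n (\<lambda>i. f (d i)))"
    then have ij: "i < n" "j < n" using M by (auto simp: real_diag_def)
    have "complex_of_real (d i) * M $$ (i, j) = M $$ (i, j) * complex_of_real (d j)"
      using arg_cong[OF comm, of "\<lambda>X. X $$ (i, j)"] unfolding index_mult_real_diag[OF M ij] .
    \<comment> \<open>\<open>M\<close> links only indices with equal diagonal entries, and on these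
      the values of \<open>f\<close> agree too.\<close>
    then have "M $$ (i, j) = 0 \<or> d i = d j" by auto
    then show "(real_diag n (\<lambda>i. f (d i)) * M) $$ (i, j) = (M * real_diag n (\<lambda>i. f (d i))) $$ (i, j)"
      unfolding index_mult_real_diag[OF M ij] by auto
  qed (use M in \<open>auto simp: real_diag_def\<close>)
  then have "P * (real_diag n (\<lambda>i. f (d i)) * M) * P' = P * (M * real_diag n (\<lambda>i. f (d i))) * P'"
    by simp
  moreover have "P * (real_diag n (\<lambda>i. f (d i)) * M) * P' = P * real_diag n (\<lambda>i. f (d i)) * Q * (Q' * P')"
    using P P' Q Q' by (simp add: M_def assoc)
  moreover have "P * (M * real_diag n (\<lambda>i. f (d i))) * P' = (P * Q) * (Q' * real_diag n (\<lambda>i. f (d i)) * P')"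
    using P P' Q Q' by (simp add: M_def assoc)
  ultimately have "P * real_diag n (\<lambda>i. f (d i)) * Q = Q' * real_diag n (\<lambda>i. f (d i)) * P'"
    using P Q P' Q' by (simp add: Q'P' PQ)
  then show ?thesis unfolding adj by (rule sym)
qed

section \<open>Existence and uniqueness of the positive square root\<close>

lemma psd_sqrt_exists:
  assumes A: "A \<in> carrier_mat n n" "psd A"
  obtains B where "B \<in> carrier_mat n n" "psd B" "B * B = A"
proof -
  from psd_diagonalization[OF A] obtain P Q d where
    P: "P \<in> carrier_mat n n" and Q: "Q \<in> carrier_mat n n" and PQ: "P * Q = 1\<^sub>m n" and QP: "Q * P = 1\<^sub>m n"
    and AD: "A = P * real_diag n d * Q" and d: "\<And>i. i < n \<Longrightarrow> 0 \<le> d i" by blast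
  define F where "F f = P * real_diag n (\<lambda>i. f (d i)) * Q" for f :: "real \<Rightarrow> real"
  have F: "F f \<in> carrier_mat n n" for f using P Q by (simp add: F_def)
  have adj: "mat_adjoint (F f) = F f" for f
    unfolding F_def using adjoint_conj_real_diag[OF P Q PQ QP] psdD(1)[OF A(2,1)] by (simp add: AD)
  have mult: "F f * F g = F (\<lambda>x. f x * g x)" for f g
  proof -
    have "F f * F g = P * real_diag n (\<lambda>i. f (d i)) * (Q * P) * real_diag n (\<lambda>i. g (d i)) * Q"
      using P Q by (simp add: F_def square_mult_assoc[of _ n])
    also have "\<dots> = P * (real_diag n (\<lambda>i. f (d i)) * real_diag n (\<lambda>i. g (d i))) * Q"
      using P Q unfolding QP by (simp add: square_mult_assoc[of _ n])
    finally show ?thesis by (simp add: real_diag_mult F_def)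
  qed
  \<comment> \<open>Only values at the nonnegative eigenvalues count, so identities such as
    \<open>sqrt x * sqrt x = x\<close>, false for negative \<open>x\<close>, may be used.\<close>
  have cong: "F f = F g" if "\<And>x. 0 \<le> x \<Longrightarrow> f x = g x" for f g
  proof -
    have "real_diag n (\<lambda>i. f (d i)) = real_diag n (\<lambda>i. g (d i))"
      by (rule eq_matI) (auto simp: real_diag_def that d)
    then show ?thesis by (simp add: F_def)
  qed
  \<comment> \<open>Without unitarity of \<open>P\<close>, nonnegative diagonal entries do not by
    themselves give positivity; it follows because \<open>F sqrt\<close> is the adjoint of the
    fourth root times the fourth root.\<close>
  have "psd (mat_adjoint (F (\<lambda>x. sqrt (sqrt x))) * F (\<lambda>x. sqrt (sqrt x)))"
    by (rule psd_adjoint_mult[OF F])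
  also have "mat_adjoint (F (\<lambda>x. sqrt (sqrt x))) * F (\<lambda>x. sqrt (sqrt x)) = F sqrt"
    unfolding adj mult by (rule cong) simp
  finally have "psd (F sqrt)" .
  moreover have "F sqrt * F sqrt = A"
    unfolding mult AD using cong[of "\<lambda>x. sqrt x * sqrt x" "\<lambda>x. x"] by (simp add: F_def)
  ultimately show thesis using that[OF F] by blast
qed

text \<open>A basis of eigenvectors of \<open>B\<close> consists of eigenvectors of \<open>C\<^sup>2\<close>, hence of \<open>C\<close>.\<close>

lemma psd_sqrt_unique:
  assumes B: "B \<in> carrier_mat n n" "psd B" and C: "C \<in> carrier_mat n n" "psd C"
    and eq: "B * B = C * C"
  shows "B = C"
proof -
  from psd_diagonalization[OF B] obtain P Q d where
    P: "P \<in> carrier_mat n n" and Q: "Q \<in> carrier_mat n n" and PQ: "P * Q = 1\<^sub>m n" and QP: "Q * P = 1\<^sub>m n"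
    and BD: "B = P * real_diag n d * Q" and d: "\<And>i. i < n \<Longrightarrow> 0 \<le> d i" by blast
  have BP: "B * P = P * real_diag n d"
  proof -
    have "B * P = P * real_diag n d * (Q * P)"
      unfolding BD using P Q by (simp add: square_mult_assoc[of _ n])
    then show ?thesis using P by (simp add: QP)
  qed
  have cols: "col (B * P) i = col (C * P) i" if i: "i < n" for i
  proof -
    define p where "p = col P i"
    have p: "p \<in> carrier_vec n" using P i by (auto simp: p_def)
    have "B *\<^sub>v p = col (B * P) i" using col_mult2[OF B(1) P i] by (simp add: p_def)
    also have "\<dots> = complex_of_real (d i) \<cdot>\<^sub>v p"
      unfolding BP by (rule eq_vecI)
        (use P i in \<open>auto simp: p_def index_mult_real_diag(1)[OF P] simp del: index_mult_mat(1)\<close>)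
    finally have Bp: "B *\<^sub>v p = complex_of_real (d i) \<cdot>\<^sub>v p" .
    have "C *\<^sub>v (C *\<^sub>v p) = (C * C) *\<^sub>v p"
      using C p by (simp add: assoc_mult_mat_vec[of _ n n _ n])
    also have "\<dots> = B *\<^sub>v (B *\<^sub>v p)"
      using B p by (simp add: eq[symmetric] assoc_mult_mat_vec[of _ n n _ n])
    also have "\<dots> = (complex_of_real (d i))\<^sup>2 \<cdot>\<^sub>v p"
      using B p by (simp add: Bp mult_mat_vec[of _ n n] smult_smult_assoc power2_eq_square)
    finally have "C *\<^sub>v p = complex_of_real (d i) \<cdot>\<^sub>v p"
      using psd_eigenvector_of_square[OF C p d[OF i]] by simp
    then show ?thesis using Bp col_mult2[OF B(1) P i] col_mult2[OF C(1) P i] by (simp add: p_def)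
  qed
  have "B * P = C * P"
    by (rule mat_col_eqI) (use cols B C P in auto)
  then have "B * P * Q = C * P * Q" by simp
  then show ?thesis using B C P Q by (simp add: square_mult_assoc[of _ n] PQ)
qed

lemma psd_sqrt_eqI:
  assumes "B \<in> carrier_mat n n" "psd B" "B * B = A"
  shows "psd_sqrt A = B"
  unfolding psd_sqrt_def
proof (rule the_equality)
  show "B \<in> carrier_mat (dim_row A) (dim_row A) \<and> psd B \<and> B * B = A" using assms by auto
  fix C assume "C \<in> carrier_mat (dim_row A) (dim_row A) \<and> psd C \<and> C * C = A"
  then show "C = B" using assms by (intro psd_sqrt_unique[of C n B]) auto
qed

lemma psd_sqrt:
  assumes "A \<in> carrier_mat n n" "psd A"
  shows "psd_sqrt A \<in> carrier_mat n n" "psd (psd_sqrt A)" "psd_sqrt A * psd_sqrt A = A"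
proof -
  obtain B where B: "B \<in> carrier_mat n n" "psd B" "B * B = A" using psd_sqrt_exists[OF assms] .
  with psd_sqrt_eqI[OF B] 
  show "psd_sqrt A \<in> carrier_mat n n" "psd (psd_sqrt A)" "psd_sqrt A * psd_sqrt A = A" by simp_all
qed

lemma abs_op_psd:
  assumes "A \<in> carrier_mat n n" "psd A"
  shows "abs_op A = A"
  unfolding abs_op_def using psd_sqrt_eqI[OF assms] psdD(1)[OF assms(2,1)] by simp

section \<open>Tensor products of operators\<close>

lemma kron_carrier [simp]:
  "A \<in> carrier_mat m n \<Longrightarrow> B \<in> carrier_mat m' n' \<Longrightarrow> kron A B \<in> carrier_mat (m * m') (n * n')"
  by (auto simp: kron_def)

lemma dim_kron [simp]:
  "dim_row (kron A B) = dim_row A * dim_row B" "dim_col (kron A B) = dim_col A * dim_col B"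
  by (simp_all add: kron_def)

lemma index_kron:
  assumes "r < dim_row A * dim_row B" "s < dim_col A * dim_col B"
  shows "kron A B $$ (r, s) =
    A $$ (r div dim_row B, s div dim_col B) * B $$ (r mod dim_row B, s mod dim_col B)"
  using assms by (simp add: kron_def)

lemma div_mod_bounds:
  fixes r a b :: nat
  assumes "r < a * b"
  shows "r div b < a" "r mod b < b"
  using assms by (auto simp: less_mult_imp_div_less) (metis mod_less_divisor mult_0_right not_gr_zero not_less_zero)

lemma sum_div_mod:
  fixes f :: "nat \<Rightarrow> nat \<Rightarrow> 'a :: comm_monoid_add"
  shows "(\<Sum>k<m * n. f (k div n) (k mod n)) = (\<Sum>i<m. \<Sum>j<n. f i j)"
proof -
  have "(\<Sum>k<m * n. f (k div n) (k mod n)) = (\<Sum>(i, j)\<in>{..<m} \<times> {..<n}. f i j)"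
  proof (rule sum.reindex_bij_witness[where i = "\<lambda>(i, j). i * n + j" and j = "\<lambda>k. (k div n, k mod n)"])
    fix p assume p: "p \<in> {..<m} \<times> {..<n}"
    then obtain i j where ij: "p = (i, j)" "i < m" "j < n" by auto
    have "i * n + j < Suc i * n" using ij by simp
    also have "\<dots> \<le> m * n" using ij by (intro mult_le_mono1) simp
    finally show "(case p of (i, j) \<Rightarrow> i * n + j) \<in> {..<m * n}" using ij by simp
  qed (auto dest: div_mod_bounds)
  also have "\<dots> = (\<Sum>i<m. \<Sum>j<n. f i j)" by (simp add: sum.cartesian_product)
  finally show ?thesis .
qed

text \<open>The summation index of the product splits into quotient and remainder, and the resulting
  double sum factors.\<close>

lemma kron_mult:
  assumes "dim_col A = dim_row A'" "dim_col B = dim_row B'"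
  shows "kron A B * kron A' B' = kron (A * A') (B * B')"
proof (rule eq_matI)
  fix r s assume "r < dim_row (kron (A * A') (B * B'))" "s < dim_col (kron (A * A') (B * B'))"
  then have r: "r < dim_row A * dim_row B" and s: "s < dim_col A' * dim_col B'" by auto
  note rb = div_mod_bounds[OF r] and sb = div_mod_bounds[OF s]
  let ?n = "dim_row B'" and ?m = "dim_row A'"
  have "(kron A B * kron A' B') $$ (r, s) = (\<Sum>k<?m * ?n. kron A B $$ (r, k) * kron A' B' $$ (k, s))"
    using r s assms by (simp add: scalar_prod_def atLeast0LessThan)
  also have "\<dots> = (\<Sum>k<?m * ?n.
      (A $$ (r div dim_row B, k div ?n) * A' $$ (k div ?n, s div dim_col B')) *
      (B $$ (r mod dim_row B, k mod ?n) * B' $$ (k mod ?n, s mod dim_col B')))"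
    using r s assms by (intro sum.cong) (auto simp: index_kron)
  also have "\<dots> = (\<Sum>i<?m. \<Sum>j<?n.
      (A $$ (r div dim_row B, i) * A' $$ (i, s div dim_col B')) *
      (B $$ (r mod dim_row B, j) * B' $$ (j, s mod dim_col B')))"
    by (rule sum_div_mod)
  also have "\<dots> = kron (A * A') (B * B') $$ (r, s)"
    using r s rb sb assms by (simp add: index_kron scalar_prod_def atLeast0LessThan sum_product)
  finally show "(kron A B * kron A' B') $$ (r, s) = kron (A * A') (B * B') $$ (r, s)" .
qed (use assms in auto)

lemma kron_adjoint: "mat_adjoint (kron A B) = kron (mat_adjoint A) (mat_adjoint B)"
proof (rule eq_matI)
  fix r s assume "r < dim_row (kron (mat_adjoint A) (mat_adjoint B))" "s < dim_col (kron (mat_adjoint A) (mat_adjoint B))"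
  then have r: "r < dim_col A * dim_col B" and s: "s < dim_row A * dim_row B" by auto
  show "mat_adjoint (kron A B) $$ (r, s) = kron (mat_adjoint A) (mat_adjoint B) $$ (r, s)"
    using r s div_mod_bounds[OF r] div_mod_bounds[OF s] by (simp add: index_kron)
qed auto

lemma kron_smult_left: "kron (a \<cdot>\<^sub>m A) B = a \<cdot>\<^sub>m kron A B"
proof (rule eq_matI)
  fix r s assume "r < dim_row (a \<cdot>\<^sub>m kron A B)" "s < dim_col (a \<cdot>\<^sub>m kron A B)"
  then have r: "r < dim_row A * dim_row B" and s: "s < dim_col A * dim_col B" by auto
  show "kron (a \<cdot>\<^sub>m A) B $$ (r, s) = (a \<cdot>\<^sub>m kron A B) $$ (r, s)"
    using r s div_mod_bounds[OF r] div_mod_bounds[OF s] by (simp add: index_kron)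
qed auto

lemma kron_smult_right: "kron A (a \<cdot>\<^sub>m B) = a \<cdot>\<^sub>m kron A B"
proof (rule eq_matI)
  fix r s assume "r < dim_row (a \<cdot>\<^sub>m kron A B)" "s < dim_col (a \<cdot>\<^sub>m kron A B)"
  then have r: "r < dim_row A * dim_row B" and s: "s < dim_col A * dim_col B" by auto
  show "kron A (a \<cdot>\<^sub>m B) $$ (r, s) = (a \<cdot>\<^sub>m kron A B) $$ (r, s)"
    using r s div_mod_bounds[OF r] div_mod_bounds[OF s] by (simp add: index_kron)
qed auto

lemma kron_one: "kron (1\<^sub>m m) (1\<^sub>m n) = 1\<^sub>m (m * n)"
proof (rule eq_matI)
  fix r s assume "r < dim_row (1\<^sub>m (m * n) :: complex mat)" "s < dim_col (1\<^sub>m (m * n) :: complex mat)"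
  then have rs: "r < m * n" "s < m * n" by auto
  have "r = s \<longleftrightarrow> r div n = s div n \<and> r mod n = s mod n" by (metis div_mod_decomp)
  then show "kron (1\<^sub>m m) (1\<^sub>m n) $$ (r, s) = (1\<^sub>m (m * n) :: complex mat) $$ (r, s)"
    using rs by (auto simp: index_kron div_mod_bounds)
qed auto

lemma tensor_op_simps [simp]:
  "tensor_op [] = 1\<^sub>m 1" "tensor_op (A # As) = kron A (tensor_op As)"
  by (simp_all add: tensor_op_def)

lemma dim_tensor_op:
  "dim_row (tensor_op As) = (\<Prod>A\<leftarrow>As. dim_row A)" "dim_col (tensor_op As) = (\<Prod>A\<leftarrow>As. dim_col A)"
  by (induction As) auto

lemma tensor_op_mult:
  assumes "\<And>x. x \<in> set xs \<Longrightarrow> dim_col (f x) = dim_row (g x)"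
  shows "tensor_op (map f xs) * tensor_op (map g xs) = tensor_op (map (\<lambda>x. f x * g x) xs)"
  using assms
proof (induction xs)
  case (Cons x xs)
  have "map dim_col (map f xs) = map dim_row (map g xs)" using Cons.prems by simp
  then have "dim_col (tensor_op (map f xs)) = dim_row (tensor_op (map g xs))"
    unfolding dim_tensor_op by (simp only:)
  then show ?case using Cons by (simp add: kron_mult)
qed simp

lemma tensor_op_adjoint:
  "mat_adjoint (tensor_op (map f xs)) = tensor_op (map (\<lambda>x. mat_adjoint (f x)) xs)"
  by (induction xs) (simp_all add: kron_adjoint adjoint_one)

lemma tensor_op_smult:
  assumes "distinct xs" "y \<in> set xs"
  shows "tensor_op (map (f(y := a \<cdot>\<^sub>m f y)) xs) = a \<cdot>\<^sub>m tensor_op (map f xs)"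
  using assms
proof (induction xs)
  case (Cons x xs)
  show ?case
  proof (cases "x = y")
    case True
    then have "map (f(y := a \<cdot>\<^sub>m f y)) xs = map f xs" using Cons.prems by auto
    then have "tensor_op (map (f(y := a \<cdot>\<^sub>m f y)) xs) = tensor_op (map f xs)" by (simp only:)
    then show ?thesis using True by (simp add: kron_smult_left fun_upd_def)
  qed (use Cons in \<open>auto simp: kron_smult_right\<close>)
qed simp

section \<open>Operators on a chain of two-dimensional factors\<close>

text \<open>Describing the factors by a function of their number makes an operator on a few factors
  a function update of the constant identity, and lets products be taken factor by factor.\<close>

definition site_op :: "nat \<Rightarrow> (nat \<Rightarrow> complex mat) \<Rightarrow> complex mat" where
  "site_op N f = tensor_op (map f [0..<N])"

lemma site_op_carrier:
  assumes "\<And>I. I < N \<Longrightarrow> f I \<in> carrier_mat 2 2"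
  shows "site_op N f \<in> carrier_mat (2 ^ N) (2 ^ N)"
proof -
  have "map dim_row (map f [0..<N]) = replicate N 2" "map dim_col (map f [0..<N]) = replicate N 2"
    using carrier_matD[OF assms] by (auto intro!: nth_equalityI)
  then show ?thesis
    unfolding site_op_def by (intro carrier_matI) (simp_all only: dim_tensor_op prod_list_replicate)
qed

lemma site_op_cong: "(\<And>I. I < N \<Longrightarrow> f I = g I) \<Longrightarrow> site_op N f = site_op N g"
  by (auto simp: site_op_def intro!: arg_cong[of _ _ tensor_op])

lemma site_op_mult:
  assumes "\<And>I. I < N \<Longrightarrow> f I \<in> carrier_mat 2 2" "\<And>I. I < N \<Longrightarrow> g I \<in> carrier_mat 2 2"
  shows "site_op N f * site_op N g = site_op N (\<lambda>I. f I * g I)"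
  unfolding site_op_def
  by (rule tensor_op_mult) (use carrier_matD[OF assms(1)] carrier_matD[OF assms(2)] in auto)

lemma site_op_adjoint: "mat_adjoint (site_op N f) = site_op N (\<lambda>I. mat_adjoint (f I))"
  unfolding site_op_def by (rule tensor_op_adjoint)

lemma site_op_smult: "I < N \<Longrightarrow> site_op N (f(I := a \<cdot>\<^sub>m A)) = a \<cdot>\<^sub>m site_op N (f(I := A))"
  using tensor_op_smult[of "[0..<N]" I "f(I := A)" a] by (simp add: site_op_def)

lemma site_op_one: "site_op N (\<lambda>_. 1\<^sub>m 2) = 1\<^sub>m (2 ^ N)"
proof -
  have "tensor_op (map (\<lambda>_. 1\<^sub>m 2) xs) = 1\<^sub>m (2 ^ length xs)" for xs :: "nat list"
    by (induction xs) (simp_all add: kron_one)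
  from this[of "[0..<N]"] show ?thesis by (simp add: site_op_def)
qed

text \<open>The digit of \<open>r\<close> that belongs to the tensor factor \<open>I\<close>; factor \<open>0\<close> has the most
  significant digit.\<close>

definition site_bit :: "nat \<Rightarrow> nat \<Rightarrow> nat \<Rightarrow> nat" where
  "site_bit N r I = r div 2 ^ (N - 1 - I) mod 2"

text \<open>Induction on the factors: the leading binary digit belongs to the first factor, and
  reduction modulo \<open>2 ^ m\<close>, with \<open>m\<close> the number of remaining factors,
  keeps their digits intact.\<close>

lemma index_tensor_op:
  assumes "\<And>A. A \<in> set As \<Longrightarrow> A \<in> carrier_mat 2 2" "r < 2 ^ length As" "s < 2 ^ length As"
  shows "tensor_op As $$ (r, s) =
    (\<Prod>I<length As. As ! I $$ (site_bit (length As) r I, site_bit (length As) s I))"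
  using assms
proof (induction As arbitrary: r s)
  case (Cons A As)
  let ?m = "length As"
  have "map dim_row As = replicate ?m 2" "map dim_col As = replicate ?m 2"
    using Cons.prems(1) by (auto intro!: nth_equalityI) (metis carrier_matD nth_mem)+
  then have dims: "dim_row (tensor_op As) = 2 ^ ?m" "dim_col (tensor_op As) = 2 ^ ?m"
    by (simp_all only: dim_tensor_op prod_list_replicate)
  have bit0: "site_bit (length (A # As)) t 0 = t div 2 ^ ?m" if "t < 2 ^ length (A # As)" for t
  proof -
    have "t div 2 ^ ?m < 2" using that by (intro div_mod_bounds(1)) simp
    then show ?thesis by (simp add: site_bit_def)
  qed
  have bitS: "site_bit (length (A # As)) t (Suc I) = site_bit ?m (t mod 2 ^ ?m) I" if "I < ?m" for t I
  proof -
    define k where "k = ?m - 1 - I"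
    have k: "?m = k + Suc I" using that by (simp add: k_def)
    have "t mod 2 ^ (k + Suc I) div 2 ^ k = t div 2 ^ k mod 2 ^ Suc I"
      by (simp only: div_exp_mod_exp_eq)
    then have "t mod 2 ^ (k + Suc I) div 2 ^ k mod 2 = t div 2 ^ k mod 2"
      by (simp only: mod_mod_cancel[OF dvd_power[OF disjI1[OF zero_less_Suc]]])
    then show ?thesis by (simp add: site_bit_def k)
  qed
  have "tensor_op (A # As) $$ (r, s) =
      A $$ (r div 2 ^ ?m, s div 2 ^ ?m) * tensor_op As $$ (r mod 2 ^ ?m, s mod 2 ^ ?m)"
    using Cons.prems carrier_matD[OF Cons.prems(1)[of A]] by (simp add: index_kron dims)
  also have "\<dots> = A $$ (r div 2 ^ ?m, s div 2 ^ ?m) *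
      (\<Prod>I<?m. As ! I $$ (site_bit ?m (r mod 2 ^ ?m) I, site_bit ?m (s mod 2 ^ ?m) I))"
    using Cons by (subst Cons.IH) auto
  also have "\<dots> = (\<Prod>I<length (A # As). (A # As) ! I $$
      (site_bit (length (A # As)) r I, site_bit (length (A # As)) s I))"
    unfolding length_Cons prod.lessThan_Suc_shift
    using bit0[OF Cons.prems(2)] bit0[OF Cons.prems(3)] bitS by simp
  finally show ?case .
qed simp

lemma index_site_op:
  assumes "\<And>I. I < N \<Longrightarrow> f I \<in> carrier_mat 2 2" "r < 2 ^ N" "s < 2 ^ N"
  shows "site_op N f $$ (r, s) = (\<Prod>I<N. f I $$ (site_bit N r I, site_bit N s I))"
proof -
  have "\<And>A. A \<in> set (map f [0..<N]) \<Longrightarrow> A \<in> carrier_mat 2 2" using assms(1) by auto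
  from index_tensor_op[of "map f [0..<N]" r s, OF this] show ?thesis using assms by (simp add: site_op_def)
qed

lemma site_op_diagonal:
  assumes "\<And>I. I < N \<Longrightarrow> f I \<in> carrier_mat 2 2" "\<And>I. I < N \<Longrightarrow> diagonal_mat (f I)"
  shows "diagonal_mat (site_op N f)"
proof -
  have kron: "diagonal_mat (kron A B)"
    if "diagonal_mat A" "diagonal_mat B" "dim_row A = dim_col A" "dim_row B = dim_col B" for A B
    unfolding diagonal_mat_def
  proof (intro allI impI)
    fix r s assume rs: "r < dim_row (kron A B)" "s < dim_col (kron A B)" "r \<noteq> s"
    have "r div dim_row B \<noteq> s div dim_row B \<or> r mod dim_row B \<noteq> s mod dim_row B"
      using rs(3) by (metis div_mod_decomp)
    with rs that show "kron A B $$ (r, s) = 0"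
      by (auto simp: index_kron diagonal_mat_def dest: div_mod_bounds)
  qed
  have "diagonal_mat (tensor_op (map f xs)) \<and> dim_row (tensor_op (map f xs)) = dim_col (tensor_op (map f xs))"
    if "set xs \<subseteq> {..<N}" for xs
    using that
  proof (induction xs)
    case Nil show ?case by (auto simp: diagonal_mat_def)
  next
    case (Cons x xs)
    then show ?case using assms carrier_matD[OF assms(1)] by (auto intro!: kron)
  qed
  moreover have "set [0..<N] \<subseteq> {..<N}" by auto
  ultimately show ?thesis unfolding site_op_def by blast
qed

section \<open>Sums of operators\<close>

lemma smult_smult_mat: "a \<cdot>\<^sub>m (b \<cdot>\<^sub>m A) = (a * b :: complex) \<cdot>\<^sub>m A"
  by (rule eq_matI) auto

lemma smult_mult_smult:
  fixes A B :: "complex mat"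
  assumes "A \<in> carrier_mat d d" "B \<in> carrier_mat d d"
  shows "(a \<cdot>\<^sub>m A) * (b \<cdot>\<^sub>m B) = (a * b) \<cdot>\<^sub>m (A * B)"
  using assms by (simp add: mult_smult_assoc_mat[of _ d d _ d] mult_smult_distrib[of _ d d _ d] smult_smult_mat mult.commute)

lemma mat_sum_carrier [simp]: "mat_sum d f S \<in> carrier_mat d d"
  by (simp add: mat_sum_def)

lemma dim_mat_sum [simp]: "dim_row (mat_sum d f S) = d" "dim_col (mat_sum d f S) = d"
  by (simp_all add: mat_sum_def)

lemma index_mat_sum [simp]: "r < d \<Longrightarrow> s < d \<Longrightarrow> mat_sum d f S $$ (r, s) = (\<Sum>x\<in>S. f x $$ (r, s))"
  by (simp add: mat_sum_def)

lemma index_mat_sum_mult: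
  assumes "\<And>x. x \<in> S \<Longrightarrow> f x \<in> carrier_mat d d" "\<And>y. y \<in> S' \<Longrightarrow> g y \<in> carrier_mat d d"
    and rs: "r < d" "s < d"
  shows "(mat_sum d f S * mat_sum d g S') $$ (r, s) = (\<Sum>x\<in>S. \<Sum>y\<in>S'. (f x * g y) $$ (r, s))"
proof -
  have "(mat_sum d f S * mat_sum d g S') $$ (r, s) =
      (\<Sum>t<d. \<Sum>x\<in>S. \<Sum>y\<in>S'. f x $$ (r, t) * g y $$ (t, s))"
    using rs by (simp add: scalar_prod_def atLeast0LessThan sum_product)
  also have "\<dots> = (\<Sum>x\<in>S. \<Sum>t<d. \<Sum>y\<in>S'. f x $$ (r, t) * g y $$ (t, s))"
    by (rule sum.swap)
  also have "\<dots> = (\<Sum>x\<in>S. \<Sum>y\<in>S'. \<Sum>t<d. f x $$ (r, t) * g y $$ (t, s))"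
    by (intro sum.cong refl sum.swap)
  also have "\<dots> = (\<Sum>x\<in>S. \<Sum>y\<in>S'. (f x * g y) $$ (r, s))"
  proof (intro sum.cong refl)
    fix x y assume "x \<in> S" "y \<in> S'"
    with assms(1,2) have "f x \<in> carrier_mat d d" "g y \<in> carrier_mat d d" by auto
    then show "(\<Sum>t<d. f x $$ (r, t) * g y $$ (t, s)) = (f x * g y) $$ (r, s)"
      using rs by (simp add: scalar_prod_def atLeast0LessThan)
  qed
  finally show ?thesis .
qed

lemma mat_sum_mult_vec:
  assumes "\<And>x. x \<in> S \<Longrightarrow> f x \<in> carrier_mat d d" "v \<in> carrier_vec d" "r < d"
  shows "(mat_sum d f S *\<^sub>v v) $ r = (\<Sum>x\<in>S. (f x *\<^sub>v v) $ r)"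
proof -
  have "(mat_sum d f S *\<^sub>v v) $ r = (\<Sum>t<d. \<Sum>x\<in>S. f x $$ (r, t) * v $ t)"
    using assms by (simp add: scalar_prod_def atLeast0LessThan sum_distrib_right)
  also have "\<dots> = (\<Sum>x\<in>S. \<Sum>t<d. f x $$ (r, t) * v $ t)" by (rule sum.swap)
  also have "\<dots> = (\<Sum>x\<in>S. (f x *\<^sub>v v) $ r)"
  proof (rule sum.cong)
    fix x assume "x \<in> S"
    from assms(1)[OF this] show "(\<Sum>t<d. f x $$ (r, t) * v $ t) = (f x *\<^sub>v v) $ r"
      using assms(2,3) by (auto simp: scalar_prod_def atLeast0LessThan)
  qed simp
  finally show ?thesis .
qed

lemma mat_sum_adjoint:
  assumes "\<And>x. x \<in> S \<Longrightarrow> f x \<in> carrier_mat d d" "\<And>x. x \<in> S \<Longrightarrow> mat_adjoint (f x) = f x"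
  shows "mat_adjoint (mat_sum d f S) = mat_sum d f S"
proof (rule eq_matI)
  fix r s assume "r < dim_row (mat_sum d f S)" "s < dim_col (mat_sum d f S)"
  then have rs: "r < d" "s < d" by auto
  have "cnj (f x $$ (s, r)) = f x $$ (r, s)" if "x \<in> S" for x
    using index_mat_adjoint[of r "f x" s] assms[OF that] rs by auto
  then show "mat_adjoint (mat_sum d f S) $$ (r, s) = mat_sum d f S $$ (r, s)"
    using rs by simp
qed auto

lemma mult_mat_sum:
  assumes A: "A \<in> carrier_mat d d" and f: "\<And>x. x \<in> S \<Longrightarrow> f x \<in> carrier_mat d d"
  shows "A * mat_sum d f S = mat_sum d (\<lambda>x. A * f x) S" "mat_sum d f S * A = mat_sum d (\<lambda>x. f x * A) S"
proof -
  \<comment> \<open>A single operator is a one-term sum, so the product rule for two sums covers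
    both sides.\<close>
  have A_eq: "A = mat_sum d (\<lambda>_. A) {()}" by (rule eq_matI) (use A in auto)
  show "A * mat_sum d f S = mat_sum d (\<lambda>x. A * f x) S"
  proof (rule eq_matI)
    fix r s assume "r < dim_row (mat_sum d (\<lambda>x. A * f x) S)" "s < dim_col (mat_sum d (\<lambda>x. A * f x) S)"
    then show "(A * mat_sum d f S) $$ (r, s) = mat_sum d (\<lambda>x. A * f x) S $$ (r, s)"
      using index_mat_sum_mult[of "{()}" "\<lambda>_. A" d S f r s] A f unfolding A_eq[symmetric] by simp
  qed (use A in auto)
  show "mat_sum d f S * A = mat_sum d (\<lambda>x. f x * A) S"
  proof (rule eq_matI)
    fix r s assume "r < dim_row (mat_sum d (\<lambda>x. f x * A) S)" "s < dim_col (mat_sum d (\<lambda>x. f x * A) S)"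
    then show "(mat_sum d f S * A) $$ (r, s) = mat_sum d (\<lambda>x. f x * A) S $$ (r, s)"
      using index_mat_sum_mult[of S f d "{()}" "\<lambda>_. A" r s] A f unfolding A_eq[symmetric] by simp
  qed (use A in auto)
qed

lemma psd_mat_sum:
  assumes f: "\<And>x. x \<in> S \<Longrightarrow> f x \<in> carrier_mat d d" "\<And>x. x \<in> S \<Longrightarrow> psd (f x)"
  shows "psd (mat_sum d f S)"
proof (rule psdI)
  show "mat_adjoint (mat_sum d f S) = mat_sum d f S"
    by (rule mat_sum_adjoint) (use f psdD(1) in auto)
  fix v :: "complex vec" assume v: "v \<in> carrier_vec d"
  have fv: "f x *\<^sub>v v \<in> carrier_vec d" if "x \<in> S" for x using f(1)[OF that] v by simp
  have "(mat_sum d f S *\<^sub>v v) \<bullet>c v = (\<Sum>r<d. \<Sum>x\<in>S. (f x *\<^sub>v v) $ r * cnj (v $ r))"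
    using v f(1) by (simp add: scalar_prod_def[of "mat_sum d f S *\<^sub>v v"] mat_sum_mult_vec atLeast0LessThan
        sum_distrib_right del: index_mult_mat_vec)
  also have "\<dots> = (\<Sum>x\<in>S. \<Sum>r<d. (f x *\<^sub>v v) $ r * cnj (v $ r))" by (rule sum.swap)
  also have "\<dots> = (\<Sum>x\<in>S. (f x *\<^sub>v v) \<bullet>c v)"
    using v by (intro sum.cong refl) (simp add: scalar_prod_def[of "f _ *\<^sub>v v"] atLeast0LessThan del: index_mult_mat_vec)
  finally show "0 \<le> Re ((mat_sum d f S *\<^sub>v v) \<bullet>c v)"
    using psdD(2)[OF f(2) f(1) v] by (simp add: sum_nonneg)
qed simp

section \<open>The fundamental representation\<close>

lemma smult_pow_mat:
  fixes A :: "complex mat"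
  assumes "A \<in> carrier_mat n n"
  shows "(a \<cdot>\<^sub>m A) ^\<^sub>m k = a ^ k \<cdot>\<^sub>m (A ^\<^sub>m k)"
proof (induction k)
  case 0
  show ?case using assms by (auto intro!: eq_matI)
next
  case (Suc k)
  have "A ^\<^sub>m k \<in> carrier_mat n n" using assms by simp
  then show ?case using assms Suc
    by (auto simp: mult_smult_assoc_mat[of _ n n _ n] mult_smult_distrib[of _ n n _ n] mult.commute intro!: eq_matI)
qed

text \<open>A crude bound, but enough to dominate the entries of the exponential series by the
  scalar series of \<open>exp (n * M)\<close>.\<close>

lemma norm_pow_mat_le:
  fixes A :: "complex mat"
  assumes A: "A \<in> carrier_mat n n" and M: "\<And>i j. i < n \<Longrightarrow> j < n \<Longrightarrow> norm (A $$ (i, j)) \<le> M"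
    and ij: "i < n" "j < n"
  shows "norm ((A ^\<^sub>m k) $$ (i, j)) \<le> (real n * M) ^ k"
  using ij
proof (induction k arbitrary: i j)
  case 0
  then show ?case using A by simp
next
  case (Suc k)
  have Ak: "A ^\<^sub>m k \<in> carrier_mat n n" using A by simp
  have "norm ((A ^\<^sub>m Suc k) $$ (i, j)) = norm (\<Sum>l<n. (A ^\<^sub>m k) $$ (i, l) * A $$ (l, j))"
    using A Ak Suc.prems by (simp add: scalar_prod_def atLeast0LessThan)
  also have "\<dots> \<le> (\<Sum>l<n. (real n * M) ^ k * M)"
  proof (rule sum_norm_le)
    fix l assume "l \<in> {..<n}"
    then have l: "l < n" by simp
    have "0 \<le> M" using M[OF l l] norm_ge_zero order_trans by blast
    then show "norm ((A ^\<^sub>m k) $$ (i, l) * A $$ (l, j)) \<le> (real n * M) ^ k * M"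
      unfolding norm_mult using Suc.IH[OF Suc.prems(1) l] M[OF l Suc.prems(2)] by (intro mult_mono) auto
  qed
  also have "\<dots> = (real n * M) ^ Suc k" by simp
  finally show ?case .
qed

text \<open>At spin 1/2 the representation is the identity map, so the derivative is that of
  \<open>exp (t X)\<close>, whose entries are power series in \<open>t\<close> with the entry of
  \<open>X\<close> as linear coefficient.\<close>

lemma spin_rep_deriv_fundamental:
  assumes X: "X \<in> carrier_mat 2 2"
  shows "spin_rep_deriv 1 X = X"
proof (rule eq_matI)
  fix r s assume "r < dim_row X" "s < dim_col X"
  then have rs: "r < 2" "s < 2" using X by auto
  define c where "c k = (X ^\<^sub>m k) $$ (r, s) / fact k" for k
  define M where "M = Max ((\<lambda>(i, j). norm (X $$ (i, j))) ` ({..<2} \<times> {..<2}))"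
  have M: "norm (X $$ (i, j)) \<le> M" if "i < 2" "j < 2" for i j
    unfolding M_def by (rule Max_ge) (use that in auto)
  have "summable (\<lambda>k. inverse (fact k) * (real 2 * M) ^ k)" by (rule summable_exp)
  then have "summable c"
  proof (rule summable_comparison_test'[where N = 0])
    fix k :: nat
    show "norm (c k) \<le> inverse (fact k) * (real 2 * M) ^ k"
      using norm_pow_mat_le[OF X M rs, of k] by (simp add: c_def norm_divide divide_simps)
  qed
  \<comment> \<open>Convergence at \<open>K = 1\<close> covers a disc around \<open>0\<close>, where
    the series may be differentiated term by term.\<close>
  then have "((\<lambda>z. \<Sum>k. c k * z ^ k) has_field_derivative (\<Sum>k. diffs c k * 0 ^ k)) (at 0)"
    by (intro termdiffs_strong[where K = 1]) auto
  then have "((\<lambda>z. \<Sum>k. c k * z ^ k) has_field_derivative c 1) (at (complex_of_real 0))"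
    by (simp only: powser_zero) (simp add: diffs_def)
  from has_vector_derivative_real_field[OF this, of UNIV]
  have "((\<lambda>t. \<Sum>k. c k * complex_of_real t ^ k) has_vector_derivative c 1) (at 0)" .
  moreover have "spin_rep 1 (mat_exp (complex_of_real t \<cdot>\<^sub>m X)) $$ (r, s) = (\<Sum>k. c k * complex_of_real t ^ k)" for t
  proof -
    have "mat_exp (complex_of_real t \<cdot>\<^sub>m X) \<in> carrier_mat 2 2" using X by (simp add: mat_exp_def)
    then have "spin_rep 1 (mat_exp (complex_of_real t \<cdot>\<^sub>m X)) $$ (r, s) = mat_exp (complex_of_real t \<cdot>\<^sub>m X) $$ (r, s)"
      by (simp only: spin_rep_fundamental)
    also have "\<dots> = (\<Sum>k. c k * complex_of_real t ^ k)"
      using X rs pow_carrier_mat[OF X]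
      by (simp add: mat_exp_def smult_pow_mat[OF X] c_def mult.commute)
    finally show ?thesis .
  qed
  ultimately show "spin_rep_deriv 1 X $$ (r, s) = X $$ (r, s)"
    using rs X by (simp add: spin_rep_deriv_def vector_derivative_at c_def)
qed (use X in \<open>auto simp: spin_rep_deriv_def\<close>)

section \<open>Pauli matrices\<close>

lemma mat2_eqI:
  assumes "A \<in> carrier_mat 2 2" "B \<in> carrier_mat 2 2"
    "A $$ (0, 0) = B $$ (0, 0)" "A $$ (0, 1) = B $$ (0, 1)" "A $$ (1, 0) = B $$ (1, 0)" "A $$ (1, 1) = B $$ (1, 1)"
  shows "A = B"
  by (rule eq_matI) (use assms in \<open>auto simp: less_2_cases_iff\<close>)

lemma index_mult_mat2:
  assumes "A \<in> carrier_mat 2 2" "B \<in> carrier_mat 2 2" "i < 2" "j < 2"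
  shows "(A * B) $$ (i, j) = A $$ (i, 0) * B $$ (0, j) + A $$ (i, 1) * B $$ (1, j)"
  using assms by (simp add: scalar_prod_def numeral_2_eq_2)

lemma pauli_carrier [simp]: "pauli i \<in> carrier_mat 2 2"
  by (auto simp: pauli_def mat_of_rows_list_def)

lemma tau_carrier [simp]: "tau i \<in> carrier_mat 2 2"
  by (simp add: tau_def)

text \<open>With the identity as index \<open>0\<close> the four matrices are closed under
  multiplication up to a phase.\<close>

definition pauli4 :: "nat \<Rightarrow> complex mat" where
  "pauli4 i = (if i = 0 then 1\<^sub>m 2 else pauli i)"

lemma pauli4_carrier [simp]: "pauli4 i \<in> carrier_mat 2 2"
  by (simp add: pauli4_def)

lemma index_pauli4:
  "pauli4 i $$ (0, 0) = (if i = 1 \<or> i = 2 then 0 else 1)"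
  "pauli4 i $$ (0, Suc 0) = (if i = 1 then 1 else if i = 2 then - \<i> else 0)"
  "pauli4 i $$ (Suc 0, 0) = (if i = 1 then 1 else if i = 2 then \<i> else 0)"
  "pauli4 i $$ (Suc 0, Suc 0) = (if i = 1 \<or> i = 2 then 0 else if i = 0 then 1 else - 1)"
  by (simp_all add: pauli4_def pauli_def mat_of_rows_list_def)

lemma adjoint_pauli4: "mat_adjoint (pauli4 i) = pauli4 i"
proof -
  have "dim_row (pauli4 i) = 2" "dim_col (pauli4 i) = 2" using carrier_matD[OF pauli4_carrier[of i]] by auto
  then show ?thesis by (intro mat2_eqI) (simp_all add: index_pauli4)
qed

definition pauli_phase :: "nat \<Rightarrow> nat \<Rightarrow> complex" where
  "pauli_phase i j =
    (if i = 0 \<or> j = 0 \<or> i = j then 1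
     else if (i, j) \<in> {(1, 2), (2, 3), (3, 1)} then \<i> else - \<i>)"

text \<open>For distinct nonzero \<open>i\<close> and \<open>j\<close> the product is a multiple of
  the third Pauli matrix, whose index is \<open>6 - i - j\<close> because
  \<open>1 + 2 + 3 = 6\<close>.\<close>

definition pauli_index :: "nat \<Rightarrow> nat \<Rightarrow> nat" where
  "pauli_index i j = (if i = 0 then j else if j = 0 then i else if i = j then 0 else 6 - i - j)"

lemma pauli4_mult:
  assumes "i \<le> 3" "j \<le> 3"
  shows "pauli4 i * pauli4 j = pauli_phase i j \<cdot>\<^sub>m pauli4 (pauli_index i j)"
proof -
  have "i \<in> {0, 1, 2, 3}" "j \<in> {0, 1, 2, 3}" using assms by auto
  then show ?thesis
    by (intro mat2_eqI; elim insertE emptyE)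
      (simp_all add: index_mult_mat2 index_pauli4 pauli_phase_def pauli_index_def
        carrier_matD[OF pauli4_carrier] del: index_mult_mat(1))
qed

section \<open>Operators acting on three tensor factors\<close>

definition triple_site_op ::
  "nat \<Rightarrow> nat \<Rightarrow> nat \<Rightarrow> nat \<Rightarrow> complex mat \<Rightarrow> complex mat \<Rightarrow> complex mat \<Rightarrow> complex mat" where
  "triple_site_op N I J K A B C = site_op N ((\<lambda>_. 1\<^sub>m 2)(I := A, J := B, K := C))"

lemma triple_site_op_carrier:
  "A \<in> carrier_mat 2 2 \<Longrightarrow> B \<in> carrier_mat 2 2 \<Longrightarrow> C \<in> carrier_mat 2 2 \<Longrightarrow>
    triple_site_op N I J K A B C \<in> carrier_mat (2 ^ N) (2 ^ N)"
  unfolding triple_site_op_def by (rule site_op_carrier) auto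

lemma triple_site_op_mult:
  assumes "distinct [I, J, K]"
    "A \<in> carrier_mat 2 2" "B \<in> carrier_mat 2 2" "C \<in> carrier_mat 2 2"
    "A' \<in> carrier_mat 2 2" "B' \<in> carrier_mat 2 2" "C' \<in> carrier_mat 2 2"
  shows "triple_site_op N I J K A B C * triple_site_op N I J K A' B' C' =
    triple_site_op N I J K (A * A') (B * B') (C * C')"
  unfolding triple_site_op_def
  by (subst site_op_mult) (use assms in \<open>auto intro!: site_op_cong\<close>)

lemma triple_site_op_adjoint:
  "mat_adjoint (triple_site_op N I J K A B C) =
    triple_site_op N I J K (mat_adjoint A) (mat_adjoint B) (mat_adjoint C)"
  unfolding triple_site_op_def site_op_adjoint by (auto intro!: site_op_cong simp: adjoint_one)

lemma triple_site_op_smult: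
  assumes "distinct [I, J, K]" "I < N" "J < N" "K < N"
  shows "triple_site_op N I J K (a \<cdot>\<^sub>m A) (b \<cdot>\<^sub>m B) (c \<cdot>\<^sub>m C) = (a * b * c) \<cdot>\<^sub>m triple_site_op N I J K A B C"
proof -
  let ?one = "\<lambda>_. 1\<^sub>m 2 :: complex mat"
  have "triple_site_op N I J K (a \<cdot>\<^sub>m A) (b \<cdot>\<^sub>m B) (c \<cdot>\<^sub>m C) =
      c \<cdot>\<^sub>m site_op N (?one(I := a \<cdot>\<^sub>m A, J := b \<cdot>\<^sub>m B, K := C))"
    unfolding triple_site_op_def by (rule site_op_smult[OF assms(4)])
  \<comment> \<open>Updates at distinct factors commute; each reordering moves the next scaled
    factor outermost, as \<open>site_op_smult\<close> demands.\<close>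
  also have "?one(I := a \<cdot>\<^sub>m A, J := b \<cdot>\<^sub>m B, K := C) = ?one(I := a \<cdot>\<^sub>m A, K := C, J := b \<cdot>\<^sub>m B)"
    using assms(1) by auto
  also have "site_op N (?one(I := a \<cdot>\<^sub>m A, K := C, J := b \<cdot>\<^sub>m B)) =
      b \<cdot>\<^sub>m site_op N (?one(I := a \<cdot>\<^sub>m A, K := C, J := B))"
    by (rule site_op_smult[OF assms(3)])
  also have "?one(I := a \<cdot>\<^sub>m A, K := C, J := B) = ?one(J := B, K := C, I := a \<cdot>\<^sub>m A)"
    using assms(1) by auto
  also have "site_op N (?one(J := B, K := C, I := a \<cdot>\<^sub>m A)) = a \<cdot>\<^sub>m site_op N (?one(J := B, K := C, I := A))"
    by (rule site_op_smult[OF assms(2)])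
  also have "?one(J := B, K := C, I := A) = ?one(I := A, J := B, K := C)"
    using assms(1) by auto
  finally show ?thesis unfolding triple_site_op_def by (simp only: smult_smult_mat mult_ac)
qed

definition pauli_triple :: "nat \<Rightarrow> nat \<Rightarrow> nat \<Rightarrow> nat \<Rightarrow> nat \<times> nat \<times> nat \<Rightarrow> complex mat" where
  "pauli_triple N I J K = (\<lambda>(i, j, k). triple_site_op N I J K (pauli4 i) (pauli4 j) (pauli4 k))"

lemma pauli_triple_carrier [simp]: "pauli_triple N I J K x \<in> carrier_mat (2 ^ N) (2 ^ N)"
  by (cases x) (simp add: pauli_triple_def triple_site_op_carrier)

lemma adjoint_pauli_triple: "mat_adjoint (pauli_triple N I J K x) = pauli_triple N I J K x"
  by (cases x) (simp add: pauli_triple_def triple_site_op_adjoint adjoint_pauli4)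

text \<open>Reduces products of Pauli triples to arithmetic on indices and phases, so that the
  operator squares below become finite computations.\<close>

lemma pauli_triple_mult:
  assumes "distinct [I, J, K]" "I < N" "J < N" "K < N" "i \<le> 3" "j \<le> 3" "k \<le> 3" "i' \<le> 3" "j' \<le> 3" "k' \<le> 3"
  shows "pauli_triple N I J K (i, j, k) * pauli_triple N I J K (i', j', k') =
    (pauli_phase i i' * pauli_phase j j' * pauli_phase k k') \<cdot>\<^sub>m
      pauli_triple N I J K (pauli_index i i', pauli_index j j', pauli_index k k')"
  using assms unfolding pauli_triple_def prod.case
  by (subst triple_site_op_mult) (simp_all only: pauli4_carrier pauli4_mult triple_site_op_smult)

text \<open>\<open>cross_op\<close> is the triple product \<open>\<sigma>\<^sub>I \<bullet> (\<sigma>\<^sub>J \<times> \<sigma>\<^sub>K)\<close>, and \<open>doublet_op\<close>, which is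
  \<open>3 - \<sigma>\<^sub>I \<bullet> \<sigma>\<^sub>J - \<sigma>\<^sub>J \<bullet> \<sigma>\<^sub>K - \<sigma>\<^sub>I \<bullet> \<sigma>\<^sub>K\<close>, is \<open>6\<close> times the projection onto
  total spin \<open>1/2\<close> of the three factors.\<close>

definition cross_op :: "nat \<Rightarrow> nat \<Rightarrow> nat \<Rightarrow> nat \<Rightarrow> complex mat" where
  "cross_op N I J K = mat_sum (2 ^ N)
    (\<lambda>(i, j, k). levi_civita i j k \<cdot>\<^sub>m pauli_triple N I J K (i, j, k))
    {(1, 2, 3), (2, 3, 1), (3, 1, 2), (3, 2, 1), (2, 1, 3), (1, 3, 2)}"

definition doublet_op :: "nat \<Rightarrow> nat \<Rightarrow> nat \<Rightarrow> nat \<Rightarrow> complex mat" where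
  "doublet_op N I J K = mat_sum (2 ^ N)
    (\<lambda>x. (if x = (0, 0, 0) then 3 else - 1) \<cdot>\<^sub>m pauli_triple N I J K x)
    {(0, 0, 0), (1, 1, 0), (2, 2, 0), (3, 3, 0), (0, 1, 1), (0, 2, 2), (0, 3, 3), (1, 0, 1), (2, 0, 2), (3, 0, 3)}"

lemma levi_civita_real: "cnj (levi_civita i j k) = levi_civita i j k"
  by (simp add: levi_civita_def)

lemma adjoint_cross_op: "mat_adjoint (cross_op N I J K) = cross_op N I J K"
  unfolding cross_op_def
  by (rule mat_sum_adjoint) (auto simp: adjoint_smult adjoint_pauli_triple levi_civita_real)

lemma adjoint_doublet_op: "mat_adjoint (doublet_op N I J K) = doublet_op N I J K"
  unfolding doublet_op_def
  by (rule mat_sum_adjoint) (auto simp: adjoint_smult adjoint_pauli_triple)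

context
  fixes N I J K :: nat
  assumes dist: "distinct [I, J, K]" and less: "I < N" "J < N" "K < N"
begin

lemmas pauli_triple_products =
  smult_mult_smult[OF pauli_triple_carrier pauli_triple_carrier]
  pauli_triple_mult[OF dist less]
  carrier_matD[OF pauli_triple_carrier]
  pauli_phase_def pauli_index_def levi_civita_def

text \<open>Of the 36 products of permutations, the 6 equal pairs give the identity. The 18 pairs
  that agree in one position give each \<open>sigma^i sigma^i\<close> on the other two factors
  twice, with sign \<open>- 1\<close>. The 12 remaining ones cancel against their reversals, whose
  phases are \<open>\<i> ^ 3\<close> and \<open>(- \<i>) ^ 3\<close>.\<close>

lemma cross_op_square: "cross_op N I J K * cross_op N I J K = 2 \<cdot>\<^sub>m doublet_op N I J K"
proof (rule eq_matI)
  fix r s assume "r < dim_row (2 \<cdot>\<^sub>m doublet_op N I J K)" "s < dim_col (2 \<cdot>\<^sub>m doublet_op N I J K)"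
  then have rs: "r < 2 ^ N" "s < 2 ^ N" by (auto simp: doublet_op_def)
  show "(cross_op N I J K * cross_op N I J K) $$ (r, s) = (2 \<cdot>\<^sub>m doublet_op N I J K) $$ (r, s)"
    unfolding cross_op_def
    by (subst index_mat_sum_mult) (use rs in \<open>auto simp: doublet_op_def pauli_triple_products simp del: index_mult_mat(1)\<close>)
qed (auto simp: cross_op_def doublet_op_def)

text \<open>Let \<open>S\<close> be the sum of the three pair products \<open>sigma . sigma\<close>.
  The square of one of them is \<open>3\<close> minus twice itself, and the anticommutator of two of
  them is twice the third, so \<open>S ^ 2 = 9\<close>. The claim is this relation for
  \<open>3 - S\<close>.\<close>

lemma doublet_op_square: "doublet_op N I J K * doublet_op N I J K = 6 \<cdot>\<^sub>m doublet_op N I J K"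
proof (rule eq_matI)
  fix r s assume "r < dim_row (6 \<cdot>\<^sub>m doublet_op N I J K)" "s < dim_col (6 \<cdot>\<^sub>m doublet_op N I J K)"
  then have rs: "r < 2 ^ N" "s < 2 ^ N" by (auto simp: doublet_op_def)
  show "(doublet_op N I J K * doublet_op N I J K) $$ (r, s) = (6 \<cdot>\<^sub>m doublet_op N I J K) $$ (r, s)"
    unfolding doublet_op_def
    by (subst index_mat_sum_mult) (use rs in \<open>auto simp: pauli_triple_products simp del: index_mult_mat(1)\<close>)
qed (auto simp: doublet_op_def)

end

lemma doublet_op_carrier [simp]: "doublet_op N I J K \<in> carrier_mat (2 ^ N) (2 ^ N)"
  by (simp add: doublet_op_def)

lemma psd_doublet_op:
  assumes "distinct [I, J, K]" "I < N" "J < N" "K < N"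
  shows "psd (doublet_op N I J K)"
proof -
  let ?Y = "doublet_op N I J K"
  have Y: "?Y \<in> carrier_mat (2 ^ N) (2 ^ N)" by (simp add: doublet_op_def)
  have "psd (complex_of_real (1 / 6) \<cdot>\<^sub>m (mat_adjoint ?Y * ?Y))"
    by (intro psd_smult psd_adjoint_mult[OF Y]) simp
  also have "complex_of_real (1 / 6) \<cdot>\<^sub>m (mat_adjoint ?Y * ?Y) = ?Y"
    unfolding adjoint_doublet_op doublet_op_square[OF assms] by (rule eq_matI) auto
  finally show ?thesis .
qed

lemma tensor_dim_fundamental: "tensor_dim (replicate N 1) = 2 ^ N"
  by (simp add: tensor_dim_def flip: numeral_2_eq_2)

lemma J_op_fundamental:
  "J_op (replicate N 1) I i = site_op N ((\<lambda>_. 1\<^sub>m 2)(I := tau i))"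
  unfolding J_op_def site_op_def
  by (intro arg_cong[of _ _ tensor_op]) (auto simp: spin_rep_deriv_fundamental[OF tau_carrier, unfolded One_nat_def])

lemma triple_op_fundamental:
  assumes dist: "distinct [I, J, K]" and less: "I < N" "J < N" "K < N"
  shows "triple_op (replicate N 1) I J K = (\<i> / 8) \<cdot>\<^sub>m cross_op N I J K"
proof (rule eq_matI)
  let ?js = "replicate N (1 :: nat)" and ?D = "2 ^ N :: nat"
  let ?S = "{(1, 2, 3), (2, 3, 1), (3, 1, 2), (3, 2, 1), (2, 1, 3), (1, 3, 2)} :: (nat \<times> nat \<times> nat) set"
  note D = tensor_dim_fundamental[of N]
  have J_ops: "J_op ?js I i = triple_site_op N I J K (tau i) (1\<^sub>m 2) (1\<^sub>m 2)"
    "J_op ?js J i = triple_site_op N I J K (1\<^sub>m 2) (tau i) (1\<^sub>m 2)"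
    "J_op ?js K i = triple_site_op N I J K (1\<^sub>m 2) (1\<^sub>m 2) (tau i)" for i
    unfolding J_op_fundamental triple_site_op_def by (intro site_op_cong; use dist in auto)+
  have prod: "J_op ?js I i * J_op ?js J j * J_op ?js K k = (\<i> / 8) \<cdot>\<^sub>m pauli_triple N I J K (i, j, k)"
    if "i \<noteq> 0" "j \<noteq> 0" "k \<noteq> 0" for i j k
  proof -
    have tau: "tau l = (1 / (2 * \<i>)) \<cdot>\<^sub>m pauli4 l" if "l \<noteq> 0" for l
      using that by (simp add: tau_def pauli4_def)
    have "J_op ?js I i * J_op ?js J j * J_op ?js K k = triple_site_op N I J K (tau i) (tau j) (tau k)"
      unfolding J_ops using carrier_matD[OF tau_carrier] by (simp add: triple_site_op_mult[OF dist])
    also have "\<dots> = (1 / (2 * \<i>) * (1 / (2 * \<i>)) * (1 / (2 * \<i>))) \<cdot>\<^sub>m pauli_triple N I J K (i, j, k)"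
      unfolding tau[OF that(1)] tau[OF that(2)] tau[OF that(3)] triple_site_op_smult[OF dist less]
      by (simp add: pauli_triple_def)
    \<comment> \<open>Each \<open>tau\<close> contributes a factor \<open>1 / (2 * \<i>)\<close>,
      and the three together give the phase of the triple product.\<close>
    also have "1 / (2 * \<i>) * (1 / (2 * \<i>)) * (1 / (2 * \<i>)) = \<i> / 8"
      by (simp add: complex_eq_iff)
    finally show ?thesis .
  qed
  fix r s assume "r < dim_row ((\<i> / 8) \<cdot>\<^sub>m cross_op N I J K)" "s < dim_col ((\<i> / 8) \<cdot>\<^sub>m cross_op N I J K)"
  then have rs: "r < ?D" "s < ?D" by (auto simp: cross_op_def)
  let ?f = "\<lambda>(i, j, k). (levi_civita i j k \<cdot>\<^sub>m (J_op ?js I i * J_op ?js J j * J_op ?js K k)) $$ (r, s)"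
  have "triple_op ?js I J K $$ (r, s) = (\<Sum>x\<in>{1..3} \<times> {1..3} \<times> {1..3}. ?f x)"
    unfolding triple_op_def D using rs by (simp add: case_prod_unfold)
  \<comment> \<open>Of the 27 index triples only the six permutations have a nonzero Levi-Civita
    symbol.\<close>
  also have "\<dots> = (\<Sum>x\<in>?S. ?f x)"
  proof (rule sum.mono_neutral_right)
    show "\<forall>x\<in>{1..3} \<times> {1..3} \<times> {1..3} - ?S. ?f x = 0"
    proof
      fix x assume x: "x \<in> {1..3} \<times> {1..3} \<times> {1..3} - ?S"
      obtain i j k where ijk: "x = (i, j, k)" by (cases x)
      have mem: "x \<in> {1..3} \<times> {1..3} \<times> {1..3}" and notin: "x \<notin> ?S" using x by blast+
      have nz: "i \<noteq> 0" "j \<noteq> 0" "k \<noteq> 0" using mem by (simp_all add: ijk)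
      have "levi_civita i j k = 0" using notin unfolding levi_civita_def ijk by simp
      then show "?f x = 0"
        using rs carrier_matD[OF pauli_triple_carrier] unfolding ijk prod.case prod[OF nz] by simp
    qed
  qed auto
  also have "\<dots> = (\<Sum>x\<in>?S. \<i> / 8 * (case x of (i, j, k) \<Rightarrow> levi_civita i j k \<cdot>\<^sub>m pauli_triple N I J K (i, j, k)) $$ (r, s))"
  proof (intro sum.cong refl)
    fix x assume x: "x \<in> ?S"
    obtain i j k where ijk: "x = (i, j, k)" by (cases x)
    have nz: "i \<noteq> 0" "j \<noteq> 0" "k \<noteq> 0" using x by (auto simp: ijk)
    show "?f x = \<i> / 8 * (case x of (i, j, k) \<Rightarrow> levi_civita i j k \<cdot>\<^sub>m pauli_triple N I J K (i, j, k)) $$ (r, s)"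
      using rs carrier_matD[OF pauli_triple_carrier] unfolding ijk prod.case prod[OF nz] by simp
  qed
  also have "\<dots> = ((\<i> / 8) \<cdot>\<^sub>m cross_op N I J K) $$ (r, s)"
    using rs by (simp add: cross_op_def distrib_left)
  finally show "triple_op ?js I J K $$ (r, s) = ((\<i> / 8) \<cdot>\<^sub>m cross_op N I J K) $$ (r, s)" .
qed (simp_all only: triple_op_def cross_op_def tensor_dim_fundamental index_smult_mat dim_mat_sum)

text \<open>With \<open>T = cross_op\<close> and \<open>Y = doublet_op\<close>, the adjoint square
  of \<open>(\<i> / 8) T\<close> is \<open>T ^ 2 / 64 = Y / 32\<close>, whereas
  \<open>(a Y) ^ 2 = 6 a ^ 2 Y\<close>. Hence \<open>a ^ 2 = 1 / 192\<close>, that is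
  \<open>a = sqrt 3 / 24\<close>.\<close>

lemma abs_triple_op_fundamental:
  assumes "distinct [I, J, K]" "I < N" "J < N" "K < N"
  shows "abs_op (triple_op (replicate N 1) I J K) = complex_of_real (sqrt 3 / 24) \<cdot>\<^sub>m doublet_op N I J K"
  unfolding abs_op_def triple_op_fundamental[OF assms] adjoint_smult adjoint_cross_op
proof (rule psd_sqrt_eqI)
  have T: "cross_op N I J K \<in> carrier_mat (2 ^ N) (2 ^ N)" by (simp add: cross_op_def)
  have Y: "doublet_op N I J K \<in> carrier_mat (2 ^ N) (2 ^ N)" by (simp add: doublet_op_def)
  then show "complex_of_real (sqrt 3 / 24) \<cdot>\<^sub>m doublet_op N I J K \<in> carrier_mat (2 ^ N) (2 ^ N)" by simp
  show "psd (complex_of_real (sqrt 3 / 24) \<cdot>\<^sub>m doublet_op N I J K)"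
    by (intro psd_smult psd_doublet_op assms) simp
  have sq: "complex_of_real (sqrt 3) * complex_of_real (sqrt 3) = 3"
    by (simp flip: of_real_mult)
  show "complex_of_real (sqrt 3 / 24) \<cdot>\<^sub>m doublet_op N I J K * (complex_of_real (sqrt 3 / 24) \<cdot>\<^sub>m doublet_op N I J K) =
      cnj (\<i> / 8) \<cdot>\<^sub>m cross_op N I J K * ((\<i> / 8) \<cdot>\<^sub>m cross_op N I J K)"
    unfolding smult_mult_smult[OF Y Y] smult_mult_smult[OF T T] cross_op_square[OF assms] doublet_op_square[OF assms]
      smult_smult_mat by (simp add: sq)
qed

section \<open>Pairs of tensor factors and invariant tensors\<close>

definition spin_op :: "nat \<Rightarrow> nat \<Rightarrow> nat \<Rightarrow> complex mat" where
  "spin_op N i I = site_op N ((\<lambda>_. 1\<^sub>m 2)(I := pauli i))"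

text \<open>This is \<open>sigma_I . sigma_J\<close> for distinct factors only: for
  \<open>I = J\<close> the second update overwrites the first, leaving a sum of single Pauli
  matrices instead of \<open>3\<close>.\<close>

definition pair_op :: "nat \<Rightarrow> nat \<Rightarrow> nat \<Rightarrow> complex mat" where
  "pair_op N I J = mat_sum (2 ^ N) (\<lambda>i. site_op N ((\<lambda>_. 1\<^sub>m 2)(I := pauli i, J := pauli i))) {1, 2, 3}"

text \<open>Twice a component of the physical spin, since the Pauli matrices carry no factor
  1/2.\<close>

definition total_spin :: "nat \<Rightarrow> nat \<Rightarrow> complex mat" where
  "total_spin N i = mat_sum (2 ^ N) (spin_op N i) {..<N}"

lemma spin_op_carrier [simp]: "spin_op N i I \<in> carrier_mat (2 ^ N) (2 ^ N)"
  unfolding spin_op_def by (rule site_op_carrier) auto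

lemma pair_op_carrier [simp]: "pair_op N I J \<in> carrier_mat (2 ^ N) (2 ^ N)"
  by (simp add: pair_op_def)

lemma total_spin_carrier [simp]: "total_spin N i \<in> carrier_mat (2 ^ N) (2 ^ N)"
  by (simp add: total_spin_def)

lemma pair_op_commute: "pair_op N I J = pair_op N J I"
  unfolding pair_op_def by (cases "I = J") (simp_all add: fun_upd_twist)

lemma doublet_op_eq:
  assumes "distinct [I, J, K]" "r < 2 ^ N" "s < 2 ^ N"
  shows "doublet_op N I J K $$ (r, s) =
    3 * 1\<^sub>m (2 ^ N) $$ (r, s) - pair_op N I J $$ (r, s) - pair_op N J K $$ (r, s) - pair_op N I K $$ (r, s)"
proof -
  let ?one = "\<lambda>_. 1\<^sub>m 2 :: complex mat"
  have upd: "?one(L := 1\<^sub>m 2) = ?one" for L by auto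
  have G: "pauli_triple N I J K (0, 0, 0) = 1\<^sub>m (2 ^ N)"
    "pauli_triple N I J K (i, j, 0) = site_op N (?one(I := pauli4 i, J := pauli4 j))"
    "pauli_triple N I J K (0, j, k) = site_op N (?one(J := pauli4 j, K := pauli4 k))"
    "pauli_triple N I J K (i, 0, k) = site_op N (?one(I := pauli4 i, K := pauli4 k))" for i j k
    unfolding pauli_triple_def prod.case triple_site_op_def site_op_one[symmetric]
    by (intro site_op_cong; use assms in \<open>auto simp: pauli4_def\<close>)+
  have p: "pauli4 0 = 1\<^sub>m 2" "pauli4 (Suc 0) = pauli (Suc 0)" "pauli4 2 = pauli 2" "pauli4 3 = pauli 3"
    by (simp_all add: pauli4_def)
  show ?thesis
    using assms(2,3) carrier_matD[OF pauli_triple_carrier[of N I J K]]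
    by (simp add: doublet_op_def pair_op_def del: index_one_mat)
       (simp add: G p upd site_op_one del: index_one_mat)
qed

lemma spin_op_mult:
  "spin_op N i I * spin_op N i I = 1\<^sub>m (2 ^ N)" if "i \<in> {1, 2, 3}"
proof -
  have "pauli i * pauli i = 1\<^sub>m 2"
    using pauli4_mult[of i i] that by (auto simp: pauli4_def pauli_phase_def pauli_index_def intro!: eq_matI)
  then show ?thesis
    unfolding spin_op_def site_op_one[symmetric]
    by (subst site_op_mult) (auto intro!: site_op_cong)
qed

lemma spin_op_mult_distinct:
  "I \<noteq> J \<Longrightarrow> spin_op N i I * spin_op N i J = site_op N ((\<lambda>_. 1\<^sub>m 2)(I := pauli i, J := pauli i))"
  unfolding spin_op_def using carrier_matD[OF pauli_carrier[of i]]
  by (subst site_op_mult) (auto intro!: site_op_cong)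

section \<open>Vanishing of the total spin on invariant tensors\<close>

lemma diagonal_mat_mult_vec:
  fixes M :: "complex mat"
  assumes "diagonal_mat M" "M \<in> carrier_mat n n" "v \<in> carrier_vec n" "r < n"
  shows "(M *\<^sub>v v) $ r = M $$ (r, r) * v $ r"
proof -
  have "(M *\<^sub>v v) $ r = (\<Sum>s<n. M $$ (r, s) * v $ s)"
    using assms by (simp add: scalar_prod_def atLeast0LessThan)
  also have "\<dots> = (\<Sum>s<n. if s = r then M $$ (r, r) * v $ r else 0)"
    using assms by (intro sum.cong) (auto simp: diagonal_mat_def)
  finally show ?thesis using assms by simp
qed

lemma Inv_fundamentalD:
  assumes "\<iota> \<in> Inv (replicate N 1)"
  shows "\<iota> \<in> carrier_vec (2 ^ N)" "u \<in> SU2 \<Longrightarrow> site_op N (\<lambda>_. u) *\<^sub>v \<iota> = \<iota>"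
proof -
  show "\<iota> \<in> carrier_vec (2 ^ N)" using assms unfolding Inv_def tensor_dim_fundamental by simp
  assume u: "u \<in> SU2"
  then have "spin_rep 1 u = u" by (intro spin_rep_fundamental) (simp add: SU2_def)
  moreover have "map (\<lambda>_. u) [0..<N] = replicate N u" by (simp add: map_replicate_const)
  ultimately show "site_op N (\<lambda>_. u) *\<^sub>v \<iota> = \<iota>" using assms u by (auto simp: Inv_def site_op_def)
qed

lemma det_2:
  fixes A :: "complex mat"
  assumes A: "A \<in> carrier_mat 2 2"
  shows "det A = A $$ (0, 0) * A $$ (1, 1) - A $$ (0, 1) * A $$ (1, 0)"
proof -
  have "det A = (\<Sum>j<2. A $$ (0, j) * cofactor A 0 j)"
    by (rule laplace_expansion_row[OF A]) simp
  moreover have "det (mat_delete A 0 j) = A $$ (1, 1 - j)" if "j < 2" for j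
  proof -
    have "mat_delete A 0 j \<in> carrier_mat 1 1" using A by (simp add: mat_delete_def)
    then show ?thesis using A that by (auto simp: det_single mat_delete_def less_2_cases_iff)
  qed
  ultimately show ?thesis by (simp add: cofactor_def numeral_2_eq_2)
qed

lemma SU2I:
  assumes "u \<in> carrier_mat 2 2" "mat_adjoint u * u = 1\<^sub>m 2"
    "u $$ (0, 0) * u $$ (1, 1) - u $$ (0, 1) * u $$ (1, 0) = 1"
  shows "u \<in> SU2"
  using assms det_2[OF assms(1)] by (simp add: SU2_def)

text \<open>The rotation \<open>diag (cis \<theta>, cis (- \<theta>))\<close> multiplies a component of total spin \<open>m\<close> by
  \<open>cis (\<theta> * m)\<close>, which is \<open>- 1\<close> for \<open>\<theta> = pi / m\<close>.\<close>

lemma total_spin_3_Inv: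
  assumes "\<iota> \<in> Inv (replicate N 1)"
  shows "total_spin N 3 *\<^sub>v \<iota> = 0\<^sub>v (2 ^ N)"
proof (rule eq_vecI)
  fix r assume "r < dim_vec (0\<^sub>v (2 ^ N) :: complex vec)"
  then have r: "r < 2 ^ N" by simp
  note \<iota> = Inv_fundamentalD[OF assms]
  \<comment> \<open>Digit \<open>0\<close> is the eigenvector of \<open>pauli 3\<close> for
    \<open>+ 1\<close>, so \<open>m\<close> is the eigenvalue of \<open>total_spin N 3\<close> on
    the basis vector with index \<open>r\<close>.\<close>
  define sg where "sg I = (if site_bit N r I = 0 then 1 else - 1 :: real)" for I
  define m where "m = (\<Sum>I<N. sg I)"
  have bit: "site_bit N r I = 0 \<or> site_bit N r I = Suc 0" for I by (auto simp: site_bit_def)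
  have m0: "complex_of_real m * \<iota> $ r = 0"
  proof (cases "m = 0")
    case False
    define u where "u = mat 2 2 (\<lambda>(a, b). if a \<noteq> b then 0 else cis (pi / m * (if a = 0 then 1 else - 1)))"
    have u_carrier: "u \<in> carrier_mat 2 2" by (simp add: u_def)
    have "u \<in> SU2"
    proof (rule SU2I[OF u_carrier])
      show "mat_adjoint u * u = 1\<^sub>m 2"
        by (rule mat2_eqI)
          (auto simp: index_mult_mat2 u_def cis_cnj cis_mult simp del: index_mult_mat(1))
      show "u $$ (0, 0) * u $$ (1, 1) - u $$ (0, 1) * u $$ (1, 0) = 1"
        by (simp add: u_def cis_mult)
    qed
    have "\<iota> $ r = (site_op N (\<lambda>_. u) *\<^sub>v \<iota>) $ r" using \<iota>(2)[OF \<open>u \<in> SU2\<close>] by simp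
    also have "\<dots> = site_op N (\<lambda>_. u) $$ (r, r) * \<iota> $ r"
      by (rule diagonal_mat_mult_vec[OF site_op_diagonal site_op_carrier \<iota>(1) r])
        (use u_carrier in \<open>auto simp: diagonal_mat_def u_def\<close>)
    also have "site_op N (\<lambda>_. u) $$ (r, r) = (\<Prod>I<N. cis (pi / m * sg I))"
      unfolding index_site_op[OF u_carrier r r]
    proof (intro prod.cong refl)
      fix I
      show "u $$ (site_bit N r I, site_bit N r I) = cis (pi / m * sg I)"
        using bit[of I] by (auto simp: u_def sg_def)
    qed
    also have "\<dots> = cis (\<Sum>I<N. pi / m * sg I)"
      by (induction N) (simp_all add: cis_mult)
    also have "\<dots> = cis (pi / m * m)"
      unfolding m_def by (simp only: sum_distrib_left)
    also have "\<dots> = - 1" using False by simp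
    finally show ?thesis by simp
  qed simp
  have "(spin_op N 3 I *\<^sub>v \<iota>) $ r = complex_of_real (sg I) * \<iota> $ r" if I: "I < N" for I
  proof -
    let ?f = "(\<lambda>_. 1\<^sub>m 2)(I := pauli 3)"
    have diag: "diagonal_mat (?f J)" for J
      using index_pauli4(2,3)[of 3]
      by (auto simp: diagonal_mat_def pauli4_def less_2_cases_iff carrier_matD[OF pauli_carrier])
    have "(spin_op N 3 I *\<^sub>v \<iota>) $ r = site_op N ?f $$ (r, r) * \<iota> $ r"
      unfolding spin_op_def
      by (rule diagonal_mat_mult_vec[OF site_op_diagonal site_op_carrier \<iota>(1) r]) (use diag in auto)
    also have "site_op N ?f $$ (r, r) = (\<Prod>J<N. ?f J $$ (site_bit N r J, site_bit N r J))"
      by (rule index_site_op) (use r in auto)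
    also have "\<dots> = (\<Prod>J<N. if J = I then complex_of_real (sg I) else 1)"
    proof (intro prod.cong refl)
      fix J
      show "?f J $$ (site_bit N r J, site_bit N r J) = (if J = I then complex_of_real (sg I) else 1)"
        using bit[of J] index_pauli4(1,4)[of 3] by (auto simp: sg_def pauli4_def)
    qed
    finally show ?thesis using I by simp
  qed
  then have "(total_spin N 3 *\<^sub>v \<iota>) $ r = complex_of_real m * \<iota> $ r"
    unfolding total_spin_def m_def by (subst mat_sum_mult_vec[OF _ \<iota>(1) r]) (simp_all add: sum_distrib_right)
  then show "(total_spin N 3 *\<^sub>v \<iota>) $ r = 0\<^sub>v (2 ^ N) $ r" using m0 r by simp
qed (simp add: total_spin_def)

text \<open>The tensor power of \<open>u\<close> intertwines the components \<open>3\<close> and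
  \<open>i\<close> of the total spin and fixes the invariant tensor, so vanishing is carried from
  axis 3 to axis \<open>i\<close>.\<close>

lemma total_spin_conj:
  assumes "\<iota> \<in> Inv (replicate N 1)" and u: "u \<in> SU2" "u * pauli 3 = pauli i * u"
  shows "total_spin N i *\<^sub>v \<iota> = 0\<^sub>v (2 ^ N)"
proof -
  note \<iota> = Inv_fundamentalD[OF assms(1)]
  let ?U = "site_op N (\<lambda>_. u)"
  have uc: "u \<in> carrier_mat 2 2" using u by (simp add: SU2_def)
  then have U: "?U \<in> carrier_mat (2 ^ N) (2 ^ N)" by (intro site_op_carrier)
  have "spin_op N i I * ?U = ?U * spin_op N 3 I" for I
    unfolding spin_op_def
    by (subst (1 2) site_op_mult) (use uc u(2) in \<open>auto intro!: site_op_cong\<close>)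
  then have comm: "total_spin N i * ?U = ?U * total_spin N 3"
    unfolding total_spin_def by (simp add: mult_mat_sum[OF U])
  have "total_spin N i *\<^sub>v \<iota> = total_spin N i *\<^sub>v (?U *\<^sub>v \<iota>)" by (simp only: \<iota>(2)[OF u(1)])
  also have "\<dots> = (total_spin N i * ?U) *\<^sub>v \<iota>"
    using U \<iota>(1) by (simp add: assoc_mult_mat_vec[of _ "2 ^ N" "2 ^ N" _ "2 ^ N"])
  also have "\<dots> = ?U *\<^sub>v (total_spin N 3 *\<^sub>v \<iota>)"
    using U \<iota>(1) unfolding comm by (simp add: assoc_mult_mat_vec[of _ "2 ^ N" "2 ^ N" _ "2 ^ N"])
  also have "\<dots> = 0\<^sub>v (2 ^ N)"
    unfolding total_spin_3_Inv[OF assms(1)] by (rule eq_vecI) (use U in auto)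
  finally show ?thesis .
qed

lemma total_spin_Inv:
  assumes "\<iota> \<in> Inv (replicate N 1)" "i \<in> {1, 2, 3}"
  shows "total_spin N i *\<^sub>v \<iota> = 0\<^sub>v (2 ^ N)"
proof -
  define h where "h = complex_of_real (1 / sqrt 2)"
  have h: "h * h = 1 / 2" "cnj h = h" by (simp_all add: h_def flip: of_real_mult)
  have i_mult: "\<i> * (h * \<i>) = - h" by (simp add: complex_eq_iff)
  \<comment> \<open>\<open>u (- 1) 1\<close> and \<open>u \<i> \<i>\<close> are quarter turns about
    axes 2 and 1; they take axis 3 to axes 1 and 2, and \<open>h\<close> normalises the
    determinant.\<close>
  define u where "u a b = mat 2 2 (\<lambda>(r, s). h * (if r = s then 1 else if r = 0 then a else b))" for a b
  have uc: "u a b \<in> carrier_mat 2 2" for a b by (simp add: u_def)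
  have su: "u a b \<in> SU2" if "(a, b) = (- 1, 1) \<or> (a, b) = (\<i>, \<i>)" for a b
  proof (rule SU2I[OF uc])
    show "mat_adjoint (u a b) * u a b = 1\<^sub>m 2"
      by (rule mat2_eqI)
        (use that uc in \<open>auto simp: index_mult_mat2 u_def h algebra_simps simp del: index_mult_mat(1)\<close>)
    show "u a b $$ (0, 0) * u a b $$ (1, 1) - u a b $$ (0, 1) * u a b $$ (1, 0) = 1"
      using that by (auto simp: u_def h algebra_simps)
  qed
  have "u (- 1) 1 * pauli 3 = pauli 1 * u (- 1) 1" "u \<i> \<i> * pauli 3 = pauli 2 * u \<i> \<i>"
    by (rule mat2_eqI; use uc in \<open>auto simp: index_mult_mat2 simp del: index_mult_mat(1)\<close>;
      simp add: u_def pauli_def mat_of_rows_list_def i_mult)+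
  then show ?thesis
    using assms total_spin_conj[OF assms(1) su, of "-1" 1 1] total_spin_conj[OF assms(1) su, of \<i> \<i> 2]
      total_spin_3_Inv by auto
qed

section \<open>Counting pairs and triples of factors\<close>

lemma sum_square_symmetric:
  fixes f :: "nat \<Rightarrow> nat \<Rightarrow> 'a :: comm_ring_1"
  assumes "\<And>I J. f I J = f J I"
  shows "(\<Sum>I<N. \<Sum>J<N. f I J) = (\<Sum>I<N. f I I) + 2 * (\<Sum>J<N. \<Sum>I<J. f I J)"
proof (induction N)
  case (Suc N)
  have "(\<Sum>J<N. f N J) = (\<Sum>I<N. f I N)" using assms by (intro sum.cong) auto
  then show ?case using Suc by (simp add: sum.distrib algebra_simps)
qed simp

text \<open>Every index lies in \<open>N - 1\<close> pairs.\<close>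

lemma sum_pairs_add:
  fixes h :: "nat \<Rightarrow> 'a :: comm_ring_1"
  shows "(\<Sum>J<N. \<Sum>I<J. h I + h J) = (of_nat N - 1) * (\<Sum>I<N. h I)"
  by (induction N) (simp_all add: sum.distrib algebra_simps)

text \<open>Double counting of pairs inside triples. The subtraction takes place in the ring, so
  small \<open>N\<close> are no exception: their pair sum is empty or their factor is zero.\<close>

lemma sum_triples_pairs:
  fixes g :: "nat \<Rightarrow> nat \<Rightarrow> 'a :: comm_ring_1"
  shows "(\<Sum>K<N. \<Sum>J<K. \<Sum>I<J. g I J + g J K + g I K) = (of_nat N - 2) * (\<Sum>J<N. \<Sum>I<J. g I J)"
proof (induction N)
  case (Suc N)
  \<comment> \<open>The triples with largest element \<open>N\<close> contain each old pair once and
    each new pair \<open>N - 1\<close> times.\<close>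
  have "(\<Sum>J<N. \<Sum>I<J. g I J + g J N + g I N) =
      (\<Sum>J<N. \<Sum>I<J. g I J) + (\<Sum>J<N. \<Sum>I<J. g I N + g J N)"
    by (simp add: sum.distrib algebra_simps)
  also have "(\<Sum>J<N. \<Sum>I<J. g I N + g J N) = (of_nat N - 1) * (\<Sum>I<N. g I N)"
    by (rule sum_pairs_add)
  finally show ?case using Suc by (simp add: algebra_simps)
qed simp

lemma sum_ordered_triples:
  fixes h :: "nat \<times> nat \<times> nat \<Rightarrow> 'a :: comm_monoid_add"
  shows "(\<Sum>x\<in>{(I, J, K). I < J \<and> J < K \<and> K < N}. h x) = (\<Sum>K<N. \<Sum>J<K. \<Sum>I<J. h (I, J, K))"
proof -
  have "(\<Sum>K<N. \<Sum>J<K. \<Sum>I<J. h (I, J, K)) =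
      (\<Sum>(K, J, I)\<in>(SIGMA K:{..<N}. SIGMA J:{..<K}. {..<J}). h (I, J, K))"
    by (simp add: sum.Sigma split_def)
  also have "\<dots> = (\<Sum>x\<in>{(I, J, K). I < J \<and> J < K \<and> K < N}. h x)"
    by (rule sum.reindex_bij_witness[where i = "\<lambda>(I, J, K). (K, J, I)" and j = "\<lambda>(K, J, I). (I, J, K)"]) auto
  finally show ?thesis by simp
qed

text \<open>The sum of the squares of the three components of \<open>total_spin\<close> kills the
  tensor. Expanded over two factors it has \<open>N\<close> diagonal terms, each equal to
  \<open>3\<close>, and every pair twice.\<close>

lemma sum_pair_op_Inv:
  assumes "\<iota> \<in> Inv (replicate N 1)" and r: "r < 2 ^ N"
  shows "2 * (\<Sum>J<N. \<Sum>I<J. (pair_op N I J *\<^sub>v \<iota>) $ r) = - (3 * of_nat N * \<iota> $ r)"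
proof -
  let ?D = "2 ^ N :: nat"
  note \<iota> = Inv_fundamentalD(1)[OF assms(1)]
  \<comment> \<open>The diagonal value is set by hand, because \<open>pair_op\<close> is not
    \<open>sigma . sigma\<close> there; each Pauli matrix squares to the identity, which gives
    \<open>3\<close>.\<close>
  define e where "e I J = (if I = J then 3 * \<iota> $ r else (pair_op N I J *\<^sub>v \<iota>) $ r)" for I J
  have e: "e I J = (\<Sum>i\<in>{1, 2, 3}. ((spin_op N i I * spin_op N i J) *\<^sub>v \<iota>) $ r)" for I J
  proof (cases "I = J")
    case True
    have "(\<Sum>i\<in>{1, 2, 3}. ((spin_op N i I * spin_op N i I) *\<^sub>v \<iota>) $ r) = (\<Sum>i\<in>{1, 2, 3 :: nat}. \<iota> $ r)"
      using \<iota> by (intro sum.cong refl) (simp only: spin_op_mult one_mult_mat_vec)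
    then show ?thesis using True by (simp add: e_def)
  next
    case False
    show ?thesis
      unfolding spin_op_mult_distinct[OF False] using False
      by (simp only: e_def pair_op_def if_False)
        (rule mat_sum_mult_vec[OF _ \<iota> r], rule site_op_carrier, simp)
  qed
  have "0 = (\<Sum>I<N. \<Sum>J<N. ((spin_op N i I * spin_op N i J) *\<^sub>v \<iota>) $ r)" if i: "i \<in> {1, 2, 3}" for i
  proof -
    have "spin_op N i I * total_spin N i = mat_sum ?D (\<lambda>J. spin_op N i I * spin_op N i J) {..<N}" for I
      unfolding total_spin_def by (rule mult_mat_sum(1)) simp_all
    moreover have "total_spin N i * total_spin N i = mat_sum ?D (\<lambda>I. spin_op N i I * total_spin N i) {..<N}"
      using mult_mat_sum(2)[OF total_spin_carrier, of "{..<N}" "spin_op N i"] by (simp add: total_spin_def)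
    ultimately have "total_spin N i * total_spin N i =
        mat_sum ?D (\<lambda>I. mat_sum ?D (\<lambda>J. spin_op N i I * spin_op N i J) {..<N}) {..<N}"
      by simp
    moreover have "(total_spin N i * total_spin N i) *\<^sub>v \<iota> = 0\<^sub>v ?D"
    proof -
      have "(total_spin N i * total_spin N i) *\<^sub>v \<iota> = total_spin N i *\<^sub>v (total_spin N i *\<^sub>v \<iota>)"
        using \<iota> by (simp add: assoc_mult_mat_vec[of _ ?D ?D _ ?D])
      also have "\<dots> = 0\<^sub>v ?D"
        unfolding total_spin_Inv[OF assms(1) i] by (rule eq_vecI) (auto simp: carrier_matD[OF total_spin_carrier])
      finally show ?thesis .
    qed
    ultimately have "(mat_sum ?D (\<lambda>I. mat_sum ?D (\<lambda>J. spin_op N i I * spin_op N i J) {..<N}) {..<N} *\<^sub>v \<iota>) $ r = 0"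
      using r by simp
    then show ?thesis
      using \<iota> r by (simp add: mat_sum_mult_vec del: index_mult_mat_vec)
  qed
  then have "0 = (\<Sum>i\<in>{1, 2, 3 :: nat}. \<Sum>I<N. \<Sum>J<N. ((spin_op N i I * spin_op N i J) *\<^sub>v \<iota>) $ r)"
    by (intro sum.neutral[symmetric]) auto
  also have "\<dots> = (\<Sum>I<N. \<Sum>i\<in>{1, 2, 3 :: nat}. \<Sum>J<N. ((spin_op N i I * spin_op N i J) *\<^sub>v \<iota>) $ r)"
    by (rule sum.swap)
  also have "\<dots> = (\<Sum>I<N. \<Sum>J<N. e I J)"
    unfolding e by (intro sum.cong refl sum.swap)
  also have "\<dots> = (\<Sum>I<N. e I I) + 2 * (\<Sum>J<N. \<Sum>I<J. e I J)"
    by (rule sum_square_symmetric) (simp add: e_def pair_op_commute)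
  also have "(\<Sum>J<N. \<Sum>I<J. e I J) = (\<Sum>J<N. \<Sum>I<J. (pair_op N I J *\<^sub>v \<iota>) $ r)"
    by (intro sum.cong refl) (simp add: e_def)
  finally show ?thesis by (simp add: e_def algebra_simps eq_neg_iff_add_eq_0)
qed

text \<open>The constant \<open>3\<close> is shared out among the three pairs, which brings the
  triple into the form summed by \<open>sum_triples_pairs\<close>.\<close>

lemma doublet_op_mult_vec:
  assumes "distinct [I, J, K]" and v: "v \<in> carrier_vec (2 ^ N)" and r: "r < 2 ^ N"
  shows "(doublet_op N I J K *\<^sub>v v) $ r = (v $ r - (pair_op N I J *\<^sub>v v) $ r) +
    (v $ r - (pair_op N J K *\<^sub>v v) $ r) + (v $ r - (pair_op N I K *\<^sub>v v) $ r)"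
proof -
  have D: "dim_row (doublet_op N I J K) = 2 ^ N" "dim_col (doublet_op N I J K) = 2 ^ N"
    by (simp_all add: doublet_op_def)
  have "(doublet_op N I J K *\<^sub>v v) $ r = (\<Sum>s<2 ^ N. doublet_op N I J K $$ (r, s) * v $ s)"
    using v r D by (simp add: scalar_prod_def atLeast0LessThan)
  also have "\<dots> = 3 * (\<Sum>s<2 ^ N. 1\<^sub>m (2 ^ N) $$ (r, s) * v $ s) - (\<Sum>s<2 ^ N. pair_op N I J $$ (r, s) * v $ s)
      - (\<Sum>s<2 ^ N. pair_op N J K $$ (r, s) * v $ s) - (\<Sum>s<2 ^ N. pair_op N I K $$ (r, s) * v $ s)"
    using r by (simp add: doublet_op_eq[OF assms(1)] sum_distrib_left sum_subtractf left_diff_distrib mult.assoc del: index_one_mat)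
  also have "(\<Sum>s<2 ^ N. 1\<^sub>m (2 ^ N) $$ (r, s) * v $ s) = (\<Sum>s<2 ^ N. if s = r then v $ r else 0)"
    using r by (intro sum.cong) auto
  finally show ?thesis
    using v r carrier_matD[OF pair_op_carrier] by (simp add: scalar_prod_def atLeast0LessThan)
qed

section \<open>The operator q and its eigenvalue on invariant tensors\<close>

lemma q_op_fundamental:
  "q_op (replicate N 1) = complex_of_real (1 / 8) \<cdot>\<^sub>m mat_sum (2 ^ N)
     (\<lambda>(I, J, K). complex_of_real (sqrt 3 / 24) \<cdot>\<^sub>m doublet_op N I J K) {(I, J, K). I < J \<and> J < K \<and> K < N}"
proof -
  have "mat_sum (2 ^ N) (\<lambda>(I, J, K). abs_op (triple_op (replicate N 1) I J K)) {(I, J, K). I < J \<and> J < K \<and> K < N} =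
    mat_sum (2 ^ N) (\<lambda>(I, J, K). complex_of_real (sqrt 3 / 24) \<cdot>\<^sub>m doublet_op N I J K) {(I, J, K). I < J \<and> J < K \<and> K < N}"
    unfolding mat_sum_def
  proof (intro cong_mat refl, unfold prod.case, intro sum.cong refl)
    fix i j x assume "x \<in> {(I, J, K). I < J \<and> J < K \<and> K < N}"
    then obtain I J K where x: "x = (I, J, K)" "I < J" "J < K" "K < N" by auto
    then have "abs_op (triple_op (replicate N 1) I J K) = complex_of_real (sqrt 3 / 24) \<cdot>\<^sub>m doublet_op N I J K"
      by (intro abs_triple_op_fundamental) auto
    then show "(case x of (I, J, K) \<Rightarrow> abs_op (triple_op (replicate N 1) I J K)) $$ (i, j) =
      (case x of (I, J, K) \<Rightarrow> complex_of_real (sqrt 3 / 24) \<cdot>\<^sub>m doublet_op N I J K) $$ (i, j)"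
      unfolding x(1) prod.case by (rule arg_cong)
  qed
  then show ?thesis unfolding q_op_def tensor_dim_fundamental by simp
qed

lemma q_op_carrier: "q_op (replicate N 1) \<in> carrier_mat (2 ^ N) (2 ^ N)"
  unfolding q_op_fundamental by simp

text \<open>Makes the outer absolute value in the volume operator trivial and guarantees its square
  root.\<close>

lemma psd_q_op: "psd (q_op (replicate N 1))"
  unfolding q_op_fundamental
proof (intro psd_smult psd_mat_sum)
  fix x assume "x \<in> {(I, J, K). I < J \<and> J < K \<and> K < N}"
  then obtain I J K where x: "x = (I, J, K)" "I < J" "J < K" "K < N" by auto
  show "(case x of (I, J, K) \<Rightarrow> complex_of_real (sqrt 3 / 24) \<cdot>\<^sub>m doublet_op N I J K) \<in> carrier_mat (2 ^ N) (2 ^ N)"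
    by (simp add: x(1))
  have "psd (complex_of_real (sqrt 3 / 24) \<cdot>\<^sub>m doublet_op N I J K)"
    by (intro psd_smult psd_doublet_op) (use x in auto)
  then show "psd (case x of (I, J, K) \<Rightarrow> complex_of_real (sqrt 3 / 24) \<cdot>\<^sub>m doublet_op N I J K)"
    by (simp only: x(1) prod.case)
qed simp

text \<open>The constant is \<open>384 = 8 * 24 * 2\<close>, from the prefactor of
  \<open>q_op\<close>, the absolute value of one triple and the halving in
  \<open>N (N + 2) / 2\<close>.\<close>

lemma q_op_Inv:
  assumes "\<iota> \<in> Inv (replicate N 1)"
  shows "q_op (replicate N 1) *\<^sub>v \<iota> =
    complex_of_real (sqrt 3 / 384 * ((real N - 2) * real N * (real N + 2))) \<cdot>\<^sub>v \<iota>"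
proof (rule eq_vecI)
  note \<iota> = Inv_fundamentalD(1)[OF assms]
  fix r assume "r < dim_vec (complex_of_real (sqrt 3 / 384 * ((real N - 2) * real N * (real N + 2))) \<cdot>\<^sub>v \<iota>)"
  then have r: "r < 2 ^ N" using \<iota> by simp
  let ?S = "{(I, J, K). I < J \<and> J < K \<and> K < N}"
  let ?c = "complex_of_real (sqrt 3 / 24)"
  define g where "g I J = \<iota> $ r - (pair_op N I J *\<^sub>v \<iota>) $ r" for I J
  have Y: "doublet_op N I J K \<in> carrier_mat (2 ^ N) (2 ^ N)" for I J K by (simp add: doublet_op_def)
  have "(q_op (replicate N 1) *\<^sub>v \<iota>) $ r =
      1 / 8 * (\<Sum>x\<in>?S. ((case x of (I, J, K) \<Rightarrow> ?c \<cdot>\<^sub>m doublet_op N I J K) *\<^sub>v \<iota>) $ r)"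
    unfolding q_op_fundamental using \<iota> r Y
    by (subst smult_mat_mult_vec, simp, subst index_smult_vec, simp, subst mat_sum_mult_vec[OF _ \<iota> r]) auto
  also have "(\<Sum>x\<in>?S. ((case x of (I, J, K) \<Rightarrow> ?c \<cdot>\<^sub>m doublet_op N I J K) *\<^sub>v \<iota>) $ r) =
      (\<Sum>x\<in>?S. case x of (I, J, K) \<Rightarrow> ?c * (g I J + g J K + g I K))"
  proof (intro sum.cong refl)
    fix x assume "x \<in> ?S"
    then obtain I J K where x: "x = (I, J, K)" "distinct [I, J, K]" by auto
    have "((?c \<cdot>\<^sub>m doublet_op N I J K) *\<^sub>v \<iota>) $ r = ?c * (doublet_op N I J K *\<^sub>v \<iota>) $ r"
      using carrier_matD[OF Y[of I J K]] \<iota> r by (subst smult_mat_mult_vec) auto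
    then show "((case x of (I, J, K) \<Rightarrow> ?c \<cdot>\<^sub>m doublet_op N I J K) *\<^sub>v \<iota>) $ r =
        (case x of (I, J, K) \<Rightarrow> ?c * (g I J + g J K + g I K))"
      unfolding doublet_op_mult_vec[OF x(2) \<iota> r] by (simp add: x(1) g_def)
  qed
  also have "\<dots> = ?c * (\<Sum>K<N. \<Sum>J<K. \<Sum>I<J. g I J + g J K + g I K)"
    unfolding sum_ordered_triples by (simp only: prod.case sum_distrib_left)
  also have "\<dots> = ?c * ((of_nat N - 2) * (\<Sum>J<N. \<Sum>I<J. g I J))"
    unfolding sum_triples_pairs ..
  \<comment> \<open>There are \<open>N (N - 1) / 2\<close> pairs, and the pair operators add up to
    \<open>- 3 N / 2\<close>; the difference of the two is the stated factor.\<close>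
  also have "(\<Sum>J<N. \<Sum>I<J. g I J) = of_nat N * (of_nat N + 2) / 2 * \<iota> $ r"
  proof -
    have "(\<Sum>I<N. \<Sum>J<N. \<iota> $ r) = (\<Sum>I<N. \<iota> $ r) + 2 * (\<Sum>J<N. \<Sum>I<J. \<iota> $ r)"
      by (rule sum_square_symmetric) simp
    then have "2 * (\<Sum>J<N. \<Sum>I<J. \<iota> $ r) = (of_nat N * of_nat N - of_nat N) * \<iota> $ r"
      by (simp add: algebra_simps)
    moreover have "2 * (\<Sum>J<N. \<Sum>I<J. g I J) =
        2 * (\<Sum>J<N. \<Sum>I<J. \<iota> $ r) - 2 * (\<Sum>J<N. \<Sum>I<J. (pair_op N I J *\<^sub>v \<iota>) $ r)"
      by (simp only: g_def sum_subtractf right_diff_distrib)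
    ultimately have "2 * (\<Sum>J<N. \<Sum>I<J. g I J) = of_nat N * (of_nat N + 2) * \<iota> $ r"
      unfolding sum_pair_op_Inv[OF assms r] by (simp add: algebra_simps)
    then show ?thesis by (simp add: field_simps)
  qed
  finally show "(q_op (replicate N 1) *\<^sub>v \<iota>) $ r =
      (complex_of_real (sqrt 3 / 384 * ((real N - 2) * real N * (real N + 2))) \<cdot>\<^sub>v \<iota>) $ r"
    using \<iota> r by (simp add: algebra_simps)
qed (use Inv_fundamentalD(1)[OF assms] carrier_matD[OF q_op_carrier] in simp)

text \<open>With this the eigenvalue equation alone shows that the volume operator preserves the
  invariant tensors.\<close>

lemma Inv_smult:
  assumes "\<iota> \<in> Inv js"
  shows "a \<cdot>\<^sub>v \<iota> \<in> Inv js"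
proof -
  have \<iota>: "\<iota> \<in> carrier_vec (tensor_dim js)" using assms by (simp add: Inv_def)
  have "tensor_op (map (\<lambda>n. spin_rep n u) js) *\<^sub>v (a \<cdot>\<^sub>v \<iota>) = a \<cdot>\<^sub>v \<iota>" if "u \<in> SU2" for u
  proof -
    let ?U = "tensor_op (map (\<lambda>n. spin_rep n u) js)"
    have "map dim_row (map (\<lambda>n. spin_rep n u) js) = map (\<lambda>n. n + 1) js"
      "map dim_col (map (\<lambda>n. spin_rep n u) js) = map (\<lambda>n. n + 1) js"
      by (auto simp: spin_rep_def)
    then have "?U \<in> carrier_mat (tensor_dim js) (tensor_dim js)"
      unfolding tensor_dim_def by (intro carrier_matI) (simp_all only: dim_tensor_op)
    then have "?U *\<^sub>v (a \<cdot>\<^sub>v \<iota>) = a \<cdot>\<^sub>v (?U *\<^sub>v \<iota>)" using \<iota> by (rule mult_mat_vec)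
    then show ?thesis using assms that by (simp add: Inv_def)
  qed
  then show ?thesis using \<iota> by (simp add: Inv_def)
qed

theorem mainTheorem1:
  fixes \<kappa>\<^sub>0 G hbar \<gamma> c :: real and N :: nat
  assumes "\<kappa>\<^sub>0 > 0" and "G > 0" and "hbar > 0" and "\<gamma> > 0" and "c > 0"
    and "N \<ge> 2" and "even N"
  defines "js \<equiv> replicate N (1 :: nat)"
  shows "\<forall>\<iota> \<in> Inv js.
    volume_op \<kappa>\<^sub>0 G hbar \<gamma> c js *\<^sub>v \<iota> \<in> Inv js \<and>
    volume_op \<kappa>\<^sub>0 G hbar \<gamma> c js *\<^sub>v \<iota> =
      complex_of_real
        (\<kappa>\<^sub>0 / 8 * (8 * pi * G * hbar * \<gamma> / c ^ 3) powr (3 / 2) *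
         sqrt (sqrt 3 / fact 3 * ((real N - 2) * real N * (real N + 2)))) \<cdot>\<^sub>v \<iota>"
proof
  fix \<iota> assume "\<iota> \<in> Inv js"
  then have inv: "\<iota> \<in> Inv (replicate N 1)" by (simp add: js_def)
  note \<iota> = Inv_fundamentalD(1)[OF inv]
  let ?X = "(real N - 2) * real N * (real N + 2)"
  let ?pre = "\<kappa>\<^sub>0 * (8 * pi * G * hbar * \<gamma> / c ^ 3) powr (3 / 2)"
  define B where "B = psd_sqrt (q_op js)"
  have q: "q_op js \<in> carrier_mat (2 ^ N) (2 ^ N)" "psd (q_op js)"
    unfolding js_def by (rule q_op_carrier, rule psd_q_op)
  note B = psd_sqrt[OF q, folded B_def]
  \<comment> \<open>\<open>N >= 2\<close> makes the eigenvalue of q nonnegative, so that its real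
    root squares back to it.\<close>
  have X: "0 \<le> sqrt 3 / 384 * ?X" using \<open>N \<ge> 2\<close> by simp
  have "B *\<^sub>v (B *\<^sub>v \<iota>) = q_op js *\<^sub>v \<iota>"
    using B(1) \<iota> by (simp add: B(3)[symmetric] assoc_mult_mat_vec[of _ "2 ^ N" "2 ^ N" _ "2 ^ N"])
  also have "\<dots> = (complex_of_real (sqrt (sqrt 3 / 384 * ?X)))\<^sup>2 \<cdot>\<^sub>v \<iota>"
    using X unfolding js_def q_op_Inv[OF inv] by (simp only: real_sqrt_pow2 flip: of_real_power)
  finally have B\<iota>: "B *\<^sub>v \<iota> = complex_of_real (sqrt (sqrt 3 / 384 * ?X)) \<cdot>\<^sub>v \<iota>"
    by (intro psd_eigenvector_of_square[OF B(1,2) \<iota>]) (use X in auto)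
  \<comment> \<open>\<open>384 = fact 3 * 64\<close>, and the root of \<open>64\<close> is the
    \<open>8\<close> in the denominator of the claim.\<close>
  have "sqrt (sqrt 3 / 384 * ?X) = sqrt (sqrt 3 / fact 3 * ?X) / 8"
  proof -
    have "sqrt (sqrt 3 / 384 * ?X) = sqrt (sqrt 3 / fact 3 * ?X / 64)" by (simp add: fact_numeral)
    also have "\<dots> = sqrt (sqrt 3 / fact 3 * ?X) / sqrt 64" by (rule real_sqrt_divide)
    also have "sqrt 64 = (8 :: real)" by (rule real_sqrt_unique) auto
    finally show ?thesis .
  qed
  then have pre: "?pre * sqrt (sqrt 3 / 384 * ?X) =
      \<kappa>\<^sub>0 / 8 * (8 * pi * G * hbar * \<gamma> / c ^ 3) powr (3 / 2) * sqrt (sqrt 3 / fact 3 * ?X)"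
    by simp
  have "volume_op \<kappa>\<^sub>0 G hbar \<gamma> c js *\<^sub>v \<iota> = complex_of_real ?pre \<cdot>\<^sub>v (B *\<^sub>v \<iota>)"
    unfolding volume_op_def abs_op_psd[OF q] B_def[symmetric]
    by (rule smult_mat_mult_vec) (use B(1) \<iota> in auto)
  then have V: "volume_op \<kappa>\<^sub>0 G hbar \<gamma> c js *\<^sub>v \<iota> =
      complex_of_real (\<kappa>\<^sub>0 / 8 * (8 * pi * G * hbar * \<gamma> / c ^ 3) powr (3 / 2) * sqrt (sqrt 3 / fact 3 * ?X)) \<cdot>\<^sub>v \<iota>"
    unfolding B\<iota> smult_smult_assoc of_real_mult[symmetric] pre .
  then show "volume_op \<kappa>\<^sub>0 G hbar \<gamma> c js *\<^sub>v \<iota> \<in> Inv js \<and>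
    volume_op \<kappa>\<^sub>0 G hbar \<gamma> c js *\<^sub>v \<iota> =
      complex_of_real (\<kappa>\<^sub>0 / 8 * (8 * pi * G * hbar * \<gamma> / c ^ 3) powr (3 / 2) * sqrt (sqrt 3 / fact 3 * ?X)) \<cdot>\<^sub>v \<iota>"
    using Inv_smult[OF \<open>\<iota> \<in> Inv js\<close>] by simp
qed

end
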